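(* Let $\Phi_0$ be a strictly plurisubharmonic (real) quadratic form on $\mathbf{C}^n$ and let $Q$ be a (inhomogeneous) quadratic polynomial on $\mathbf{C}^n$ with complex coefficients (in the real coordinates of $\mathbf{C}^n\simeq\mathbf{R}^{2n}$), with principal (homogeneous quadratic) part $q$. Assume that $$\mathrm{Re}\, q(x) < \Phi_{\rm herm}(x) := \tfrac12\left(\Phi_0(x) + \Phi_0(ix)\right),\quad x \neq 0,$$ and $$\det\, \partial_x \partial_{\overline{x}} \left(2\Phi_0 - q\right) \neq 0.$$ Let $a\in C^{\infty}(\Lambda_{\Phi_0})$ be the Weyl symbol of the Toeplitz operator $\mathrm{Top}(e^{Q})$, and assume that $a \in L^{\infty}(\Lambda_{\Phi_0})$. Then the Toeplitz operator $\mathrm{Top}(e^{Q}): H_{\Phi_0}(\mathbf{C}^n) \rightarrow H_{\Phi_0}(\mathbf{C}^n)$ is bounded.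
   Context: $\Lambda_{\Phi_0} = \{(x,\frac{2}{i}\frac{\partial \Phi_0}{\partial x}(x)) : x\in \mathbf{C}^n\} \subset \mathbf{C}^{2n}$, where $\partial/\partial x$ is the holomorphic derivative. The Bargmann space is $H_{\Phi_0}(\mathbf{C}^n) = L^2(\mathbf{C}^n, e^{-2\Phi_0} L(dx)) \cap \mathrm{Hol}(\mathbf{C}^n)$, with $L(dx)$ Lebesgue measure, and $\Pi_{\Phi_0}$ is the orthogonal projection of $L^2(\mathbf{C}^n, e^{-2\Phi_0}L(dx))$ onto $H_{\Phi_0}(\mathbf{C}^n)$. The Toeplitz operator is $\mathrm{Top}(e^Q) = \Pi_{\Phi_0}\circ e^{Q}\circ \Pi_{\Phi_0}$, with its natural (dense) domain $\{u\in H_{\Phi_0}(\mathbf{C}^n): e^{Q}u \in L^2(\mathbf{C}^n, e^{-2\Phi_0}L(dx))\}$; "bounded" means bounded on this domain (hence extends to a bounded operator on $H_{\Phi_0}$). The Weyl symbol of $\mathrm{Top}(e^Q)$ is the function $a$ on $\Lambda_{\Phi_0}$ with $\mathrm{Top}(e^Q)=a^w(x,D_x)$ (Weyl quantization realized on $H_{\Phi_0}$), explicitly given by $a(x,\xi) = \left(\exp\left(\tfrac{1}{4} (\Phi''_{0,x\overline{x}})^{-1} \partial_x \cdot \partial_{\overline{x}}\right)e^Q\right)(x)$ for $(x,\xi)\in\Lambda_{\Phi_0}$, equivalently $a(x,\xi)=C_{\Phi_0}\int_{\mathbf{C}^n}\exp(-4\Phi_{\rm herm}(x-y))e^{Q(y)}\,L(dy)$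 for a constant $C_{\Phi_0}\neq 0$. *)

theory Defs
  imports "HOL-Analysis.Analysis"
begin

text \<open>C^n is modelled as complex ^ 'n, with 'n an arbitrary finite index type.
  All linearity below is real-linearity (C^n viewed as R^2n).\<close>

definition cscale :: "complex \<Rightarrow> complex ^ 'n \<Rightarrow> complex ^ 'n" where
  "cscale c v = (\<chi> j. c * v $ j)"

definition real_qform :: "('a::real_inner \<Rightarrow> real) \<Rightarrow> bool" where
  "real_qform f \<longleftrightarrow> (\<exists>M. linear M \<and> (\<forall>x. f x = x \<bullet> M x))"

definition complex_qform :: "('a::real_inner \<Rightarrow> complex) \<Rightarrow> bool" where
  "complex_qform q \<longleftrightarrow> real_qform (\<lambda>x. Re (q x)) \<and> real_qform (\<lambda>x. Im (q x))"

definition quad_poly_with_principal_part ::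
  "('a::real_inner \<Rightarrow> complex) \<Rightarrow> ('a \<Rightarrow> complex) \<Rightarrow> bool" where
  "quad_poly_with_principal_part Q q \<longleftrightarrow>
     complex_qform q \<and> (\<exists>L c. linear L \<and> (\<forall>x. Q x = q x + L x + c))"

definition dirder :: "(complex ^ 'n \<Rightarrow> complex) \<Rightarrow> complex ^ 'n \<Rightarrow> complex ^ 'n \<Rightarrow> complex" where
  "dirder F v x = vector_derivative (\<lambda>s::real. F (x + s *\<^sub>R v)) (at 0)"

text \<open>Mixed Wirtinger derivative \<partial>_{x_j} \<partial>_{conj x_k} F at x, with
  \<partial>_{x_j} = (\<partial>_{a_j} - i \<partial>_{b_j})/2, \<partial>_{conj x_k} = (\<partial>_{a_k} + i \<partial>_{b_k})/2, x = a + i b.\<close>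
definition wirt_mixed :: "(complex ^ 'n \<Rightarrow> complex) \<Rightarrow> complex ^ 'n \<Rightarrow> 'n \<Rightarrow> 'n \<Rightarrow> complex" where
  "wirt_mixed F x j k =
     (let ea = axis j (1::complex); eb = axis j \<i>; fa = axis k (1::complex); fb = axis k \<i>;
          D2 = (\<lambda>v w. dirder (dirder F w) v x)
      in (D2 ea fa + D2 eb fb + \<i> * (D2 ea fb - D2 eb fa)) / 4)"

definition complex_hessian :: "(complex ^ 'n \<Rightarrow> complex) \<Rightarrow> complex ^ 'n \<Rightarrow> complex ^ 'n ^ 'n" where
  "complex_hessian F x = (\<chi> j k. wirt_mixed F x j k)"

definition strictly_psh :: "(complex ^ 'n \<Rightarrow> real) \<Rightarrow> bool" where
  "strictly_psh \<Phi> \<longleftrightarrow> (\<forall>x t. t \<noteq> 0 \<longrightarrow>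
     0 < Re (\<Sum>j\<in>UNIV. \<Sum>k\<in>UNIV.
       complex_hessian (\<lambda>y. complex_of_real (\<Phi> y)) x $ j $ k * t $ j * cnj (t $ k)))"

definition phi_herm :: "(complex ^ 'n \<Rightarrow> real) \<Rightarrow> complex ^ 'n \<Rightarrow> real" where
  "phi_herm \<Phi> x = (\<Phi> x + \<Phi> (cscale \<i> x)) / 2"

definition cn_holomorphic :: "(complex ^ 'n \<Rightarrow> complex) \<Rightarrow> bool" where
  "cn_holomorphic u \<longleftrightarrow> (\<forall>x. \<exists>D. (u has_derivative D) (at x) \<and> (\<forall>c v. D (cscale c v) = c * D v))"

definition weighted_measure :: "(complex ^ 'n \<Rightarrow> real) \<Rightarrow> (complex ^ 'n) measure" where
  "weighted_measure \<Phi> = density lborel (\<lambda>x. ennreal (exp (- 2 * \<Phi> x)))"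

text \<open>L^2(C^n, e^{-2\<Phi>} L(dx)) (functions, not a.e. classes).\<close>
definition wL2 :: "(complex ^ 'n \<Rightarrow> real) \<Rightarrow> (complex ^ 'n \<Rightarrow> complex) set" where
  "wL2 \<Phi> = {u. u \<in> borel_measurable lborel \<and> integrable (weighted_measure \<Phi>) (\<lambda>x. (cmod (u x))\<^sup>2)}"

definition wnorm :: "(complex ^ 'n \<Rightarrow> real) \<Rightarrow> (complex ^ 'n \<Rightarrow> complex) \<Rightarrow> real" where
  "wnorm \<Phi> u = sqrt (\<integral>x. (cmod (u x))\<^sup>2 \<partial>weighted_measure \<Phi>)"

definition winner :: "(complex ^ 'n \<Rightarrow> real) \<Rightarrow> (complex ^ 'n \<Rightarrow> complex) \<Rightarrow> (complex ^ 'n \<Rightarrow> complex) \<Rightarrow> complex" where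
  "winner \<Phi> u v = (\<integral>x. u x * cnj (v x) \<partial>weighted_measure \<Phi>)"

definition bargmann_space :: "(complex ^ 'n \<Rightarrow> real) \<Rightarrow> (complex ^ 'n \<Rightarrow> complex) set" where
  "bargmann_space \<Phi> = {u. cn_holomorphic u \<and> u \<in> wL2 \<Phi>}"

definition bargmann_proj :: "(complex ^ 'n \<Rightarrow> real) \<Rightarrow> (complex ^ 'n \<Rightarrow> complex) \<Rightarrow> (complex ^ 'n \<Rightarrow> complex)" where
  "bargmann_proj \<Phi> v = (THE w. w \<in> bargmann_space \<Phi> \<and>
      (\<forall>h\<in>bargmann_space \<Phi>. winner \<Phi> (\<lambda>x. v x - w x) h = 0))"

text \<open>Top(e^Q) = \<Pi> e^Q \<Pi> is bounded on its natural domain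
  {u \<in> H_\<Phi> : e^Q u \<in> L^2}.\<close>
definition toeplitz_exp_bounded :: "(complex ^ 'n \<Rightarrow> real) \<Rightarrow> (complex ^ 'n \<Rightarrow> complex) \<Rightarrow> bool" where
  "toeplitz_exp_bounded \<Phi> Q \<longleftrightarrow> (\<exists>C. \<forall>u\<in>bargmann_space \<Phi>.
      (\<lambda>x. exp (Q x) * u x) \<in> wL2 \<Phi> \<longrightarrow>
      wnorm \<Phi> (bargmann_proj \<Phi> (\<lambda>x. exp (Q x) * u x)) \<le> C * wnorm \<Phi> u)"

text \<open>Weyl symbol of Top(e^Q), up to the nonzero constant C_\<Phi>, as a function of x,
  where (x, (2/i) \<partial>_x \<Phi>(x)) parametrizes \<Lambda>_\<Phi>.\<close>
definition toeplitz_weyl_integral :: "(complex ^ 'n \<Rightarrow> real) \<Rightarrow> (complex ^ 'n \<Rightarrow> complex) \<Rightarrow> complex ^ 'n \<Rightarrow> complex" where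
  "toeplitz_weyl_integral \<Phi> Q x =
     (\<integral>y. complex_of_real (exp (- 4 * phi_herm \<Phi> (x - y))) * exp (Q y) \<partial>lborel)"

end

theory Submission
  imports Defs "HOL-Complex_Analysis.Cauchy_Integral_Formula" "HOL-Probability.Distributions"
begin

text \<open>Write \<open>\<Phi>\<^sub>0 = N + Re f\<close> with \<open>N = \<Phi>\<^sub>h\<^sub>e\<^sub>r\<^sub>m\<close> the diagonal of a positive Hermitian form \<open>H\<close> and \<open>f\<close>
  holomorphic. The Bergman projection has kernel \<open>exp (f x + cnj (f y) + 2 H x y)\<close>, so up to the
  factor \<open>exp (f x + cnj (f s))\<close> the Toeplitz operator has the Gaussian kernel
  \<open>G x s = \<integral> exp (2 H x y + 2 H y s - 2 N y + Q y) dy\<close>. Since \<open>exp (- 2 H x s)\<close> times the integral of the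
  Weyl symbol against \<open>exp (4 H x z + 4 H z s - 4 N z)\<close> is a multiple of \<open>G x s\<close>, a bounded symbol makes
  \<open>g x s = |G x s| exp (- N x - N s)\<close> bounded. Substituting \<open>y\<^sub>1 = w + r/2\<close>, \<open>y\<^sub>2 = w - r/2\<close> in
  \<open>G x\<^sub>1 s\<^sub>1 * G x\<^sub>2 s\<^sub>2\<close> factors \<open>g x\<^sub>1 s\<^sub>1 * g x\<^sub>2 s\<^sub>2\<close> into a function of the sums and a function of the
  differences of the arguments, which serves as a substitute for the explicit Gaussian form of \<open>G\<close>.
  Together with the decay of each slice (from \<open>Re q < \<Phi>\<^sub>h\<^sub>e\<^sub>r\<^sub>m\<close>) it turns the uniform bound on \<open>g\<close> into
  uniform bounds on \<open>\<integral> g x s ds\<close> and \<open>\<integral> g x s dx\<close>, and Schur's test applies.\<close>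

section \<open>Lebesgue measure, Gaussians and Schur's test\<close>

text \<open>Evaluating \<open>G\<close> explicitly would call for the inverse and the determinant of
  a complex symmetric matrix and for a branch of its square root. Here the only Gaussian integrals
  that are kept are positive constants. The bounded symbol controls the joint growth, and without
  loss: \<open>exp (4 * H x z + 4 * H z s - 4 * N z)\<close> has modulus
  \<open>exp (N (x + s))\<close> times a Gaussian in \<open>z\<close> of fixed mass, and together
  with \<open>exp (- 2 * H x s)\<close> this produces exactly the weight
  \<open>exp (N x + N s)\<close> that \<open>g\<close> divides out. Boundedness of \<open>g\<close>
  alone gives no integrability either. For the exponential of a quadratic polynomial the Hessian
  along a slice is the same for all slices, so decay of one slice forces the same concavity on every
  slice, and the integral of a slice is at most a constant times its supremum. The factorisation in
  sums and differences encodes this constancy of the Hessian without logarithms, and stays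
  meaningful where \<open>G\<close> might vanish.\<close>

lemma nn_integral_lborel_translate:
  fixes c :: "'a::euclidean_space"
  assumes [measurable]: "f \<in> borel_measurable borel"
  shows "(\<integral>\<^sup>+x. f (c + x) \<partial>lborel) = (\<integral>\<^sup>+x. f x \<partial>lborel)"
proof -
  have "(\<integral>\<^sup>+x. f x \<partial>lborel) = (\<integral>\<^sup>+x. f x \<partial>distr lborel borel ((+) c))"
    by (simp add: lborel_distr_plus)
  then show ?thesis by (simp add: nn_integral_distr)
qed

lemma nn_integral_lborel_diff:
  fixes c :: "'a::euclidean_space"
  assumes [measurable]: "f \<in> borel_measurable borel"
  shows "(\<integral>\<^sup>+x. f (x - c) \<partial>lborel) = (\<integral>\<^sup>+x. f x \<partial>lborel)"
  using nn_integral_lborel_translate[OF assms, of "-c"] by simp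

lemma lborel_integral_translate:
  fixes c :: "'a::euclidean_space" and f :: "'a \<Rightarrow> 'b::{banach, second_countable_topology}"
  assumes [measurable]: "f \<in> borel_measurable borel"
  shows "(\<integral>x. f (c + x) \<partial>lborel) = (\<integral>x. f x \<partial>lborel)"
proof -
  have "(\<integral>x. f x \<partial>lborel) = (\<integral>x. f x \<partial>distr lborel borel ((+) c))"
    by (simp add: lborel_distr_plus)
  then show ?thesis by (simp add: integral_distr)
qed

lemma lborel_integrable_translate_iff:
  fixes c :: "'a::euclidean_space" and f :: "'a \<Rightarrow> 'b::{banach, second_countable_topology}"
  assumes [measurable]: "f \<in> borel_measurable borel"
  shows "integrable lborel (\<lambda>x. f (c + x)) \<longleftrightarrow> integrable lborel f"
proof -
  have "integrable lborel f \<longleftrightarrow> integrable (distr lborel borel ((+) c)) f"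
    by (simp add: lborel_distr_plus)
  then show ?thesis by (simp add: integrable_distr_eq)
qed

lemma lborel_integrable_scale:
  fixes a :: real and f :: "real \<Rightarrow> real"
  assumes "integrable lborel f" "a \<noteq> 0"
  shows "integrable lborel (\<lambda>x. f (a * x))"
  using lborel_integrable_real_affine[OF assms, of 0] by simp

lemma nn_integral_gauss_real:
  assumes "a > 0"
  shows "(\<integral>\<^sup>+(x::real). ennreal (exp (- a * x\<^sup>2)) \<partial>lborel) < \<infinity>"
proof -
  define f where "f = (\<lambda>x::real. indicator {0..} x *\<^sub>R exp (- x\<^sup>2))"
  have i: "integrable lborel f"
    using gaussian_moment_0 unfolding f_def has_bochner_integral_iff by blast
  have "integrable lborel (\<lambda>x. f (sqrt a * x))" "integrable lborel (\<lambda>x. f (- sqrt a * x))"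
    by (rule lborel_integrable_scale[OF i]; use assms in simp)+
  then have "integrable lborel (\<lambda>x. f (sqrt a * x) + f (- sqrt a * x))" by simp
  then have *: "(\<integral>\<^sup>+x. ennreal (norm (f (sqrt a * x) + f (- sqrt a * x))) \<partial>lborel) < \<infinity>"
    by (simp add: integrable_iff_bounded)
  \<comment> \<open>\<open>f\<close> lives on the half line, so the two reflected copies cover the
    line. They overlap at 0, hence an inequality and not an equation.\<close>
  have "exp (- a * x\<^sup>2) \<le> norm (f (sqrt a * x) + f (- sqrt a * x))" for x
    using assms by (auto simp: f_def power_mult_distrib zero_le_mult_iff mult_le_0_iff indicator_def)
  then show ?thesis
    by (intro le_less_trans[OF nn_integral_mono *]) (simp add: ennreal_leI)
qed

lemma nn_integral_gauss:
  assumes "a > 0"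
  shows "(\<integral>\<^sup>+(x::'a::euclidean_space). ennreal (exp (- a * (norm x)\<^sup>2)) \<partial>lborel) < \<infinity>"
proof -
  have "ennreal (exp (- a * (norm x)\<^sup>2)) = (\<Prod>b\<in>Basis. ennreal (exp (- a * (x \<bullet> b)\<^sup>2)))" for x :: 'a
  proof -
    have "(norm x)\<^sup>2 = (\<Sum>b\<in>Basis. (x \<bullet> b)\<^sup>2)"
      unfolding power2_norm_eq_inner euclidean_inner[of x x] by (simp add: power2_eq_square)
    then show ?thesis
      by (simp add: prod_ennreal exp_sum[symmetric] sum_distrib_left sum_negf)
  qed
  then have "(\<integral>\<^sup>+(x::'a). ennreal (exp (- a * (norm x)\<^sup>2)) \<partial>lborel)
      = (\<Prod>b\<in>(Basis::'a set). (\<integral>\<^sup>+x. ennreal (exp (- a * x\<^sup>2)) \<partial>lborel))"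
    by (simp add: nn_integral_lborel_prod[where f = "\<lambda>b x. ennreal (exp (- a * x\<^sup>2))", simplified])
  also have "\<dots> < \<infinity>"
    using nn_integral_gauss_real[OF assms] by (simp add: power_less_top_ennreal)
  finally show ?thesis .
qed

lemma integrable_gauss:
  assumes "a > 0"
  shows "integrable lborel (\<lambda>x::'a::euclidean_space. exp (- a * (norm x)\<^sup>2))"
  using nn_integral_gauss[OF assms, where 'a = 'a] by (simp add: integrable_iff_bounded)

lemma integrable_gauss_dominated:
  fixes F :: "'a::euclidean_space \<Rightarrow> 'b::{banach, second_countable_topology}"
  assumes "a > 0" and [measurable]: "F \<in> borel_measurable borel"
    and "\<And>x. norm (F x) \<le> C * exp (- a * (norm x)\<^sup>2)"
  shows "integrable lborel F"
proof (rule Bochner_Integration.integrable_bound)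
  show "integrable lborel (\<lambda>x::'a. C * exp (- a * (norm x)\<^sup>2))"
    using integrable_gauss[OF assms(1), where 'a = 'a] by simp
  show "AE x in lborel. norm (F x) \<le> norm (C * exp (- a * (norm x)\<^sup>2))"
    using assms(3) by (auto intro!: AE_I2 order_trans[OF assms(3)])
qed simp

text \<open>Haar uniqueness trick: swapping the order of integration in
  \<open>\<integral>\<integral> f (x - y) g x\<close> compares the two translation-invariant measures
  through the rotation-invariant \<open>f\<close>.\<close>

lemma lborel_distr_isometry:
  fixes R :: "'a::euclidean_space \<Rightarrow> 'a"
  assumes R: "linear R" and nR: "\<And>x. norm (R x) = norm x"
  shows "distr lborel borel R = lborel"
proof -
  have contR: "continuous_on UNIV R" using R by (simp add: linear_continuous_on linear_linear)
  then have [measurable]: "R \<in> borel_measurable borel"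
    by (rule borel_measurable_continuous_onI)
  have "inj R"
  proof (rule injI)
    fix x y assume "R x = R y"
    then have "R (x - y) = 0" using R by (simp add: linear_diff)
    then show "x = y" using nR[of "x - y"] by simp
  qed
  then have "surj R" using R by (metis linear_injective_imp_surjective)
  define f :: "'a \<Rightarrow> ennreal" where "f = (\<lambda>x. ennreal (exp (- 1 * (norm x)\<^sup>2)))"
  have [measurable]: "f \<in> borel_measurable borel" unfolding f_def by measurable
  define I where "I = (\<integral>\<^sup>+x. f x \<partial>lborel)"
  \<comment> \<open>The comparison of the two measures ends by cancelling \<open>I\<close> in
    \<open>ennreal\<close>, which requires it to be neither infinite nor 0.\<close>
  have I_fin: "I < \<infinity>" unfolding I_def f_def by (rule nn_integral_gauss) simp
  have I_pos: "I \<noteq> 0"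
  proof
    assume "I = 0"
    then have "AE x in lborel. f x = 0"
      unfolding I_def by (subst (asm) nn_integral_0_iff_AE) auto
    then have "AE x::'a in lborel. False" by (simp add: f_def)
    then have "emeasure lborel (UNIV :: 'a set) = 0"
      by (simp add: AE_iff_null null_sets_def)
    then show False by simp
  qed
  have eq: "(\<integral>\<^sup>+x. g (R x) \<partial>lborel) = (\<integral>\<^sup>+x. g x \<partial>lborel)"
    if [measurable]: "g \<in> borel_measurable borel" for g :: "'a \<Rightarrow> ennreal"
  proof -
    have "I * (\<integral>\<^sup>+y. g (R y) \<partial>lborel) = (\<integral>\<^sup>+x. f x * (\<integral>\<^sup>+y. g (R y) \<partial>lborel) \<partial>lborel)"
      unfolding I_def by (simp add: nn_integral_multc)
    also have "\<dots> = (\<integral>\<^sup>+x. (\<integral>\<^sup>+y. f x * g (x + R y) \<partial>lborel) \<partial>lborel)"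
    proof (rule nn_integral_cong)
      fix x
      obtain z where z: "R z = x" using \<open>surj R\<close> by (metis surj_def)
      have "(\<integral>\<^sup>+y. g (R y) \<partial>lborel) = (\<integral>\<^sup>+y. g (R (z + y)) \<partial>lborel)"
        by (rule nn_integral_lborel_translate[symmetric]) simp
      also have "\<dots> = (\<integral>\<^sup>+y. g (x + R y) \<partial>lborel)" using R z by (simp add: linear_add)
      finally show "f x * (\<integral>\<^sup>+y. g (R y) \<partial>lborel) = (\<integral>\<^sup>+y. f x * g (x + R y) \<partial>lborel)"
        by (simp add: nn_integral_cmult)
    qed
    also have "\<dots> = (\<integral>\<^sup>+y. (\<integral>\<^sup>+x. f x * g (x + R y) \<partial>lborel) \<partial>lborel)"
      by (rule lborel_pair.Fubini'[symmetric]) measurable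
    also have "\<dots> = (\<integral>\<^sup>+y. (\<integral>\<^sup>+x. f (x - R y) * g x \<partial>lborel) \<partial>lborel)"
    proof (rule nn_integral_cong)
      fix y
      show "(\<integral>\<^sup>+x. f x * g (x + R y) \<partial>lborel) = (\<integral>\<^sup>+x. f (x - R y) * g x \<partial>lborel)"
        using nn_integral_lborel_translate[of "\<lambda>x. f (x - R y) * g x" "R y"] by (simp add: add.commute)
    qed
    also have "\<dots> = (\<integral>\<^sup>+x. (\<integral>\<^sup>+y. f (x - R y) * g x \<partial>lborel) \<partial>lborel)"
      by (rule lborel_pair.Fubini') measurable
    also have "\<dots> = (\<integral>\<^sup>+x. I * g x \<partial>lborel)"
    proof (rule nn_integral_cong)
      fix x
      obtain z where z: "R z = x" using \<open>surj R\<close> by (metis surj_def)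
      \<comment> \<open>With \<open>x = R z\<close> the argument is \<open>R (z - y)\<close>, and
        \<open>f\<close> depends only on the norm: this is where the isometry is used.\<close>
      have "f (x - R y) = f (-z + y)" for y
        using z nR[of "z - y"] R by (simp add: f_def linear_diff norm_minus_commute)
      then have "(\<integral>\<^sup>+y. f (x - R y) \<partial>lborel) = I"
        using nn_integral_lborel_translate[of f "-z"] by (simp add: I_def)
      then show "(\<integral>\<^sup>+y. f (x - R y) * g x \<partial>lborel) = I * g x" by (simp add: nn_integral_multc)
    qed
    also have "\<dots> = I * (\<integral>\<^sup>+x. g x \<partial>lborel)" by (simp add: nn_integral_cmult)
    finally show ?thesis using I_fin I_pos by (auto simp: ennreal_mult_cancel_left)
  qed
  show ?thesis
  proof (rule measure_eqI)
    fix A assume "A \<in> sets (distr lborel borel R)"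
    then have A [measurable]: "A \<in> sets borel" by simp
    have "emeasure (distr lborel borel R) A = (\<integral>\<^sup>+x. indicator A (R x) \<partial>lborel)"
      by (simp add: nn_integral_indicator[symmetric] nn_integral_distr del: nn_integral_indicator)
    then show "emeasure (distr lborel borel R) A = emeasure lborel A" by (simp add: eq)
  qed simp
qed

lemma lborel_integral_isometry:
  fixes R :: "'a::euclidean_space \<Rightarrow> 'a" and f :: "'a \<Rightarrow> 'b::{banach, second_countable_topology}"
  assumes R: "linear R" "\<And>x. norm (R x) = norm x" and [measurable]: "f \<in> borel_measurable borel"
  shows "(\<integral>x. f (R x) \<partial>lborel) = (\<integral>x. f x \<partial>lborel)"
    and "integrable lborel (\<lambda>x. f (R x)) \<longleftrightarrow> integrable lborel f"
proof -
  have "continuous_on UNIV R" using R by (simp add: linear_continuous_on linear_linear)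
  then have [measurable]: "R \<in> borel_measurable borel"
    by (rule borel_measurable_continuous_onI)
  have "(\<integral>x. f x \<partial>lborel) = (\<integral>x. f x \<partial>distr lborel borel R)"
    by (simp add: lborel_distr_isometry[OF R])
  then show "(\<integral>x. f (R x) \<partial>lborel) = (\<integral>x. f x \<partial>lborel)" by (simp add: integral_distr)
  have "integrable lborel f \<longleftrightarrow> integrable (distr lborel borel R) f"
    by (simp add: lborel_distr_isometry[OF R])
  then show "integrable lborel (\<lambda>x. f (R x)) \<longleftrightarrow> integrable lborel f"
    by (simp add: integrable_distr_eq)
qed

text \<open>Cauchy-Schwarz for the measure with density \<open>\<kappa> x\<close>, applied to
  \<open>F\<close> and 1, costs one factor \<open>A\<close>; exchanging the integrals afterwards
  costs \<open>B\<close>. Stated in \<open>ennreal\<close>, it needs no integrability and yields it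
  instead.\<close>

lemma schur_test:
  fixes \<kappa> :: "'a \<Rightarrow> 'b \<Rightarrow> ennreal" and F :: "'b \<Rightarrow> ennreal"
  assumes "sigma_finite_measure M" "sigma_finite_measure N"
  assumes [measurable]: "case_prod \<kappa> \<in> borel_measurable (M \<Otimes>\<^sub>M N)" "F \<in> borel_measurable N"
    and A: "\<And>x. x \<in> space M \<Longrightarrow> (\<integral>\<^sup>+y. \<kappa> x y \<partial>N) \<le> A" and B: "\<And>y. y \<in> space N \<Longrightarrow> (\<integral>\<^sup>+x. \<kappa> x y \<partial>M) \<le> B"
  shows "(\<integral>\<^sup>+x. (\<integral>\<^sup>+y. \<kappa> x y * F y \<partial>N)\<^sup>2 \<partial>M) \<le> A * B * (\<integral>\<^sup>+y. (F y)\<^sup>2 \<partial>N)"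
proof -
  interpret M: sigma_finite_measure M by fact
  interpret N: sigma_finite_measure N by fact
  interpret pair_sigma_finite M N ..
  have "(\<integral>\<^sup>+y. \<kappa> x y * F y \<partial>N)\<^sup>2 \<le> A * (\<integral>\<^sup>+y. \<kappa> x y * (F y)\<^sup>2 \<partial>N)" if x [measurable]: "x \<in> space M" for x
  proof -
    have [measurable]: "(\<lambda>y. \<kappa> x y) \<in> borel_measurable N"
      by measurable
    have "(\<integral>\<^sup>+y. \<kappa> x y * F y \<partial>N)\<^sup>2
      = (\<integral>\<^sup>+y. F y * 1 \<partial>density N (\<kappa> x))\<^sup>2"
      by (subst nn_integral_density) auto
    also have "\<dots> \<le> (\<integral>\<^sup>+y. (F y)\<^sup>2 \<partial>density N (\<kappa> x)) * (\<integral>\<^sup>+y. 1\<^sup>2 \<partial>density N (\<kappa> x))"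
      by (rule Cauchy_Schwarz_nn_integral) auto
    also have "\<dots> = (\<integral>\<^sup>+y. \<kappa> x y * (F y)\<^sup>2 \<partial>N) * (\<integral>\<^sup>+y. \<kappa> x y \<partial>N)"
      by (subst (1 2) nn_integral_density) auto
    also have "\<dots> \<le> (\<integral>\<^sup>+y. \<kappa> x y * (F y)\<^sup>2 \<partial>N) * A"
      by (intro mult_left_mono A x) simp
    finally show ?thesis by (simp add: mult.commute)
  qed
  then have "(\<integral>\<^sup>+x. (\<integral>\<^sup>+y. \<kappa> x y * F y \<partial>N)\<^sup>2 \<partial>M) \<le> (\<integral>\<^sup>+x. A * (\<integral>\<^sup>+y. \<kappa> x y * (F y)\<^sup>2 \<partial>N) \<partial>M)"
    by (rule nn_integral_mono)
  also have "\<dots> = A * (\<integral>\<^sup>+x. (\<integral>\<^sup>+y. \<kappa> x y * (F y)\<^sup>2 \<partial>N) \<partial>M)"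
    by (rule nn_integral_cmult) measurable
  also have "(\<integral>\<^sup>+x. (\<integral>\<^sup>+y. \<kappa> x y * (F y)\<^sup>2 \<partial>N) \<partial>M) = (\<integral>\<^sup>+y. (\<integral>\<^sup>+x. \<kappa> x y * (F y)\<^sup>2 \<partial>M) \<partial>N)"
    by (rule Fubini'[symmetric]) measurable
  also have "\<dots> = (\<integral>\<^sup>+y. (\<integral>\<^sup>+x. \<kappa> x y \<partial>M) * (F y)\<^sup>2 \<partial>N)"
    by (intro nn_integral_cong nn_integral_multc) measurable
  also have "\<dots> \<le> (\<integral>\<^sup>+y. B * (F y)\<^sup>2 \<partial>N)"
    by (intro nn_integral_mono mult_right_mono B) auto
  also have "\<dots> = B * (\<integral>\<^sup>+y. (F y)\<^sup>2 \<partial>N)" by (rule nn_integral_cmult) measurable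
  finally show ?thesis by (simp add: mult.assoc mult_left_mono)
qed

section \<open>Entire functions and the reproducing formula\<close>

lemma cscale_simps [simp]:
  "cscale 0 v = 0" "cscale c 0 = 0" "cscale 1 v = v" "cscale c (cscale d v) = cscale (c * d) v"
  by (simp_all add: cscale_def vec_eq_iff)

lemma cscale_add: "cscale c (v + w) = cscale c v + cscale c w"
  by (simp add: cscale_def vec_eq_iff distrib_left)

lemma cscale_add_left: "cscale (c + d) v = cscale c v + cscale d v"
  by (simp add: cscale_def vec_eq_iff distrib_right)

lemma cscale_of_real: "cscale (of_real r) v = r *\<^sub>R v"
  by (simp add: cscale_def vec_eq_iff) (simp add: scaleR_conv_of_real)

lemma cscale_uminus_one [simp]: "cscale (- 1) v = - v"
  by (simp add: cscale_def vec_eq_iff)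

lemma cscale_scaleR: "cscale c (r *\<^sub>R v) = r *\<^sub>R cscale c v"
  by (simp add: cscale_of_real[symmetric] mult.commute)

lemma linear_cscale: "linear (cscale c)"
  by (rule linearI) (simp_all add: cscale_add cscale_scaleR)

lemma norm_cscale: "norm (cscale c v) = cmod c * norm v"
  by (simp add: norm_vec_def cscale_def L2_set_def norm_mult power_mult_distrib
      sum_distrib_left[symmetric] real_sqrt_mult)

lemma bounded_linear_cscale: "bounded_linear (cscale c)"
  using linear_cscale linear_conv_bounded_linear by blast

lemma bounded_linear_cscale_left: "bounded_linear (\<lambda>c. cscale c v)"
  by (rule bounded_linear_intro[of _ "norm v"])
     (simp_all add: cscale_add_left norm_cscale cscale_of_real[symmetric] scaleR_conv_of_real)

lemma cn_holomorphicI: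
  assumes "\<And>x. (u has_derivative D x) (at x)" "\<And>x c v. D x (cscale c v) = c * D x v"
  shows "cn_holomorphic u"
  using assms unfolding cn_holomorphic_def by blast

section \<open>Entire functions of several variables and the mean value property\<close>

lemma cn_holomorphicE:
  assumes "cn_holomorphic u"
  obtains D where "\<And>x. (u has_derivative D x) (at x)" "\<And>x c v. D x (cscale c v) = c * D x v"
proof -
  from assms have "\<forall>x. \<exists>D. (u has_derivative D) (at x) \<and> (\<forall>c v. D (cscale c v) = c * D v)"
    by (simp add: cn_holomorphic_def)
  from choice[OF this] show ?thesis using that by blast
qed

lemma cn_holomorphic_continuous:
  assumes "cn_holomorphic u"
  shows "continuous_on UNIV u"
  using assms has_derivative_continuous
  by (fastforce simp: cn_holomorphic_def continuous_on_eq_continuous_at)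

lemma cn_holomorphic_measurable:
  assumes "cn_holomorphic u"
  shows "u \<in> borel_measurable borel"
  by (rule borel_measurable_continuous_onI[OF cn_holomorphic_continuous[OF assms]])

lemma cn_holomorphic_mult:
  assumes "cn_holomorphic u" "cn_holomorphic v"
  shows "cn_holomorphic (\<lambda>x. u x * v x)"
proof -
  obtain D where D: "\<And>x. (u has_derivative D x) (at x)" "\<And>x c v. D x (cscale c v) = c * D x v"
    using assms(1) by (rule cn_holomorphicE) blast
  obtain E where E: "\<And>x. (v has_derivative E x) (at x)" "\<And>x c v. E x (cscale c v) = c * E x v"
    using assms(2) by (rule cn_holomorphicE) blast
  show ?thesis
    by (rule cn_holomorphicI[OF has_derivative_mult[OF D(1) E(1)]])
       (simp add: D E algebra_simps)
qed

lemma cn_holomorphic_diff: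
  assumes "cn_holomorphic u" "cn_holomorphic v"
  shows "cn_holomorphic (\<lambda>x. u x - v x)"
proof -
  obtain D where D: "\<And>x. (u has_derivative D x) (at x)" "\<And>x c v. D x (cscale c v) = c * D x v"
    using assms(1) by (rule cn_holomorphicE) blast
  obtain E where E: "\<And>x. (v has_derivative E x) (at x)" "\<And>x c v. E x (cscale c v) = c * E x v"
    using assms(2) by (rule cn_holomorphicE) blast
  show ?thesis
    by (rule cn_holomorphicI[OF has_derivative_diff[OF D(1) E(1)]])
       (simp add: D E algebra_simps)
qed

lemma cn_holomorphic_const: "cn_holomorphic (\<lambda>x. c)"
  by (rule cn_holomorphicI[where D = "\<lambda>_ _. 0"]) auto

lemma cn_holomorphic_compose:
  assumes "cn_holomorphic u" "\<And>z. (g has_field_derivative g' z) (at z)"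
  shows "cn_holomorphic (\<lambda>x. g (u x))"
proof -
  obtain D where D: "\<And>x. (u has_derivative D x) (at x)" "\<And>x c v. D x (cscale c v) = c * D x v"
    using assms(1) by (rule cn_holomorphicE) blast
  have "((\<lambda>x. g (u x)) has_derivative (\<lambda>h. g' (u x) * D x h)) (at x)" for x
    using has_derivative_compose[OF D(1) assms(2)[unfolded has_field_derivative_def]] .
  then show ?thesis by (rule cn_holomorphicI) (simp add: D)
qed

lemma cn_holomorphic_exp: "cn_holomorphic u \<Longrightarrow> cn_holomorphic (\<lambda>x. exp (u x))"
  by (rule cn_holomorphic_compose[OF _ DERIV_exp])

lemma cn_holomorphic_translate:
  assumes "cn_holomorphic u"
  shows "cn_holomorphic (\<lambda>x. u (a + x))"
proof -
  obtain D where D: "\<And>x. (u has_derivative D x) (at x)" "\<And>x c v. D x (cscale c v) = c * D x v"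
    using assms(1) by (rule cn_holomorphicE) blast
  have "((\<lambda>x. u (a + x)) has_derivative (\<lambda>h. D (a + x) h)) (at x)" for x
    by (rule has_derivative_compose[OF _ D(1), where f = "\<lambda>x. a + x" and f' = "\<lambda>x. x"])
       (auto intro!: derivative_eq_intros)
  then show ?thesis by (rule cn_holomorphicI) (simp add: D)
qed

lemma cn_holomorphic_linear:
  assumes "linear l" "\<And>c v. l (cscale c v) = c * l v"
  shows "cn_holomorphic l"
  by (rule cn_holomorphicI[where D = "\<lambda>_. l"])
     (use assms in \<open>auto intro: linear_imp_has_derivative\<close>)

text \<open>Restriction to complex lines through the origin reduces the mean value property in
  several variables to Cauchy's formula in one.\<close>

lemma cn_holomorphic_slice:
  assumes "cn_holomorphic u"
  shows "(\<lambda>c. u (cscale c v)) holomorphic_on UNIV"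
proof -
  obtain D where D: "\<And>x. (u has_derivative D x) (at x)" "\<And>x c v. D x (cscale c v) = c * D x v"
    using assms(1) by (rule cn_holomorphicE) blast
  have "((\<lambda>c. u (cscale c v)) has_derivative (\<lambda>h. D (cscale c v) (cscale h v))) (at c)" for c
    by (rule has_derivative_compose[OF bounded_linear_imp_has_derivative[OF bounded_linear_cscale_left] D(1)])
  then have "((\<lambda>c. u (cscale c v)) has_field_derivative D (cscale c v) v) (at c)" for c
    unfolding has_field_derivative_def D by (simp add: mult.commute[of _ "D _ _"])
  then show ?thesis by (auto simp: holomorphic_on_def field_differentiable_def intro: has_field_derivative_at_within)
qed

text \<open>Cauchy's formula on the unit circle: the derivative of the path is
  \<open>2 * pi * \<i>\<close> times the point, which cancels the Cauchy kernel at 0. The indicator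
  puts the average in the form of an integral over the whole line, ready for Fubini with
  \<open>lborel\<close>.\<close>

lemma mean_value_circle:
  assumes "g holomorphic_on UNIV"
  shows "(\<integral>t. indicator {0..1} t *\<^sub>R g (cis (2 * pi * t)) \<partial>lborel) = g 0"
proof -
  have cont: "continuous_on UNIV g" using assms by (rule holomorphic_on_imp_continuous_on)
  have "((\<lambda>u. g u / (u - 0)) has_contour_integral (2 * of_real pi * \<i> * g 0)) (circlepath 0 1)"
    by (rule Cauchy_integral_circlepath_simple) (auto intro: holomorphic_on_subset[OF assms])
  then have "((\<lambda>x. g (circlepath 0 1 x) / circlepath 0 1 x *
       vector_derivative (circlepath 0 1) (at x within {0..1})) has_integral 2 * of_real pi * \<i> * g 0) {0..1}"
    by (simp add: has_contour_integral_def)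
  then have "((\<lambda>x. (2 * of_real pi * \<i>) * g (cis (2 * pi * x))) has_integral (2 * of_real pi * \<i>) * g 0) {0..1}"
    by (rule has_integral_eq[rotated])
       (subst vector_derivative_circlepath01, auto simp: circlepath cis_conv_exp mult_ac)
  from has_integral_mult_right[OF this, of "1 / (2 * of_real pi * \<i>)"]
  have hi: "((\<lambda>x. g (cis (2 * pi * x))) has_integral g 0) {0..1}" by simp
  have "set_integrable lborel {0..1} (\<lambda>x. g (cis (2 * pi * x)))"
    by (intro borel_integrable_atLeastAtMost' continuous_on_compose2[OF cont] continuous_intros) auto
  from set_borel_integral_eq_integral(2)[OF this] hi show ?thesis
    by (simp add: set_lebesgue_integral_def integral_unique)
qed

text \<open>Averaging over the circle action \<open>s \<mapsto> e\<^sup>i\<^sup>t s\<close>, which preserves Lebesgue measure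
  and the weight, replaces an entire function by its value at the origin.\<close>

lemma integral_entire_rotation_invariant:
  fixes \<phi> :: "complex ^ 'n \<Rightarrow> complex" and w :: "complex ^ 'n \<Rightarrow> real"
  assumes \<phi>: "cn_holomorphic \<phi>" and [measurable]: "w \<in> borel_measurable borel"
    and w: "\<And>c s. cmod c = 1 \<Longrightarrow> w (cscale c s) = w s"
    and int: "integrable lborel (\<lambda>s. w s *\<^sub>R \<phi> s)"
  shows "(\<integral>s. w s *\<^sub>R \<phi> s \<partial>lborel) = (\<integral>s. w s *\<^sub>R \<phi> 0 \<partial>lborel)"
proof -
  note [measurable] = cn_holomorphic_measurable[OF \<phi>]
  have c2: "continuous_on UNIV (\<lambda>p. cscale (cis (2 * pi * fst p)) (snd p) :: complex ^ 'n)"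
    unfolding cscale_def by (intro continuous_intros)
  have [measurable]: "(\<lambda>p. cscale (cis (2 * pi * fst p)) (snd p) :: complex ^ 'n) \<in> borel \<Otimes>\<^sub>M borel \<rightarrow>\<^sub>M borel"
    unfolding borel_prod by (rule borel_measurable_continuous_onI[OF c2])
  have rot: "(\<integral>s. w s *\<^sub>R \<phi> (cscale c s) \<partial>lborel) = (\<integral>s. w s *\<^sub>R \<phi> s \<partial>lborel)"
    "(\<integral>s. norm (w s *\<^sub>R \<phi> (cscale c s)) \<partial>lborel) = (\<integral>s. norm (w s *\<^sub>R \<phi> s) \<partial>lborel)"
    "integrable lborel (\<lambda>s. w s *\<^sub>R \<phi> (cscale c s))" if "cmod c = 1" for c
  proof -
    have n: "norm (cscale c x) = norm x" for x :: "complex ^ 'n" using that by (simp add: norm_cscale)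
    show "(\<integral>s. w s *\<^sub>R \<phi> (cscale c s) \<partial>lborel) = (\<integral>s. w s *\<^sub>R \<phi> s \<partial>lborel)"
      using lborel_integral_isometry(1)[OF linear_cscale n, of "\<lambda>s. w s *\<^sub>R \<phi> s"] that by (simp add: w)
    show "(\<integral>s. norm (w s *\<^sub>R \<phi> (cscale c s)) \<partial>lborel) = (\<integral>s. norm (w s *\<^sub>R \<phi> s) \<partial>lborel)"
      using lborel_integral_isometry(1)[OF linear_cscale n, of "\<lambda>s. norm (w s *\<^sub>R \<phi> s)"] that by (simp add: w)
    show "integrable lborel (\<lambda>s. w s *\<^sub>R \<phi> (cscale c s))"
      using lborel_integral_isometry(2)[OF linear_cscale n, of "\<lambda>s. w s *\<^sub>R \<phi> s"] that int by (simp add: w)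
  qed
  let ?F = "\<lambda>t s. indicator {0..1} t *\<^sub>R (w s *\<^sub>R \<phi> (cscale (cis (2 * pi * t)) s))"
  \<comment> \<open>Rotation leaves the inner L1 norm unchanged, so integrability of the unrotated
    integrand already gives it on the product with the bounded parameter interval.\<close>
  have i: "integrable (lborel \<Otimes>\<^sub>M lborel) (\<lambda>(t, s). ?F t s)"
  proof (rule lborel_pair.Fubini_integrable)
    show "(\<lambda>(t, s). ?F t s) \<in> borel_measurable (lborel \<Otimes>\<^sub>M lborel)"
      unfolding split_beta by measurable
    have "integrable lborel (\<lambda>t::real. indicator {0..1} t *\<^sub>R (\<integral>s. norm (w s *\<^sub>R \<phi> s) \<partial>lborel))"
      by (intro integrable_scaleR_left) (auto simp: integrable_indicator_iff)
    then show "integrable lborel (\<lambda>t. \<integral>s. norm (case (t, s) of (t, s) \<Rightarrow> ?F t s) \<partial>lborel)"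
      by (simp only: prod.case norm_scaleR[of "indicator _ _"] integral_mult_right_zero rot(2)[OF norm_cis])
         (simp add: abs_of_nonneg)
    show "AE t in lborel. integrable lborel (\<lambda>s. case (t, s) of (t, s) \<Rightarrow> ?F t s)"
      unfolding prod.case by (intro AE_I2 integrable_scaleR_right rot(3) norm_cis)
  qed
  have "(\<integral>s. w s *\<^sub>R \<phi> s \<partial>lborel) = (\<integral>t. indicator {0..1::real} t *\<^sub>R (\<integral>s. w s *\<^sub>R \<phi> s \<partial>lborel) \<partial>lborel)"
    by simp
  also have "\<dots> = (\<integral>t. (\<integral>s. ?F t s \<partial>lborel) \<partial>lborel)"
    by (simp only: integral_scaleR_right rot(1)[OF norm_cis])
  also have "\<dots> = (\<integral>s. (\<integral>t. ?F t s \<partial>lborel) \<partial>lborel)"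
    by (rule lborel_pair.Fubini_integral[OF i, symmetric])
  also have "\<dots> = (\<integral>s. w s *\<^sub>R \<phi> 0 \<partial>lborel)"
  proof (rule Bochner_Integration.integral_cong[OF refl])
    fix s
    have "(\<integral>t. ?F t s \<partial>lborel) = (\<integral>t. w s *\<^sub>R (indicator {0..1} t *\<^sub>R \<phi> (cscale (cis (2 * pi * t)) s)) \<partial>lborel)"
      by (simp add: mult.commute)
    also have "\<dots> = w s *\<^sub>R (\<integral>t. indicator {0..1} t *\<^sub>R \<phi> (cscale (cis (2 * pi * t)) s) \<partial>lborel)"
      by (rule integral_scaleR_right)
    also have "\<dots> = w s *\<^sub>R \<phi> 0"
      using mean_value_circle[OF cn_holomorphic_slice[OF \<phi>, of s]] by simp
    finally show "(\<integral>t. ?F t s \<partial>lborel) = w s *\<^sub>R \<phi> 0" .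
  qed
  finally show ?thesis .
qed

section \<open>Positive Hermitian forms and their Gaussian weights\<close>

locale hermitian_form =
  fixes H :: "complex ^ 'n \<Rightarrow> complex ^ 'n \<Rightarrow> complex" and m :: real
  assumes add_left: "H (x + y) z = H x z + H y z"
    and cscale_left: "H (cscale c x) y = c * H x y"
    and hermitian: "H y x = cnj (H x y)"
    and m_pos: "m > 0"
    and coercive: "m * (norm x)\<^sup>2 \<le> Re (H x x)"
begin

definition N where "N x = Re (H x x)"

lemma H_diag: "H x x = of_real (N x)"
  using hermitian[of x x] by (simp add: N_def complex_eq_iff)

lemma add_right: "H z (x + y) = H z x + H z y"
  by (metis add_left hermitian complex_cnj_add)

lemma cscale_right: "H x (cscale c y) = cnj c * H x y"
  by (metis cscale_left hermitian complex_cnj_mult)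

lemma scaleR_left: "H (r *\<^sub>R x) y = of_real r * H x y"
  by (simp add: cscale_of_real[symmetric] cscale_left)

lemma scaleR_right: "H x (r *\<^sub>R y) = of_real r * H x y"
  by (simp add: cscale_of_real[symmetric] cscale_right)

lemma minus_left: "H (- x) y = - H x y"
  using scaleR_left[of "-1" x y] by simp

lemma minus_right: "H x (- y) = - H x y"
  using scaleR_right[of x "-1" y] by simp

lemma diff_left: "H (x - y) z = H x z - H y z"
  using add_left[of x "-y" z] by (simp add: minus_left)

lemma diff_right: "H z (x - y) = H z x - H z y"
  using add_right[of z x "-y"] by (simp add: minus_right)

lemma linear_left: "linear (\<lambda>x. H x y)"
  by (rule linearI) (simp_all add: add_left scaleR_left scaleR_conv_of_real[where 'a = complex])

lemma linear_right: "linear (\<lambda>y. H x y)"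
  by (rule linearI) (simp_all add: add_right scaleR_right scaleR_conv_of_real[where 'a = complex])

lemma bounded_bilinear: "bounded_bilinear H"
  using linear_left linear_right by (simp add: bilinear_conv_bounded_bilinear[symmetric] bilinear_def)

lemma H_bound: obtains K where "K > 0" "\<And>x y. cmod (H x y) \<le> K * norm x * norm y"
  using bounded_bilinear.pos_bounded[OF bounded_bilinear] by (metis mult.assoc mult.commute)

lemma continuous_on_H [continuous_intros]:
  "continuous_on A f \<Longrightarrow> continuous_on A g \<Longrightarrow> continuous_on A (\<lambda>x. H (f x) (g x))"
  by (rule bounded_bilinear.continuous_on[OF bounded_bilinear])

lemma measurable_H [measurable (raw)]:
  assumes [measurable]: "f \<in> borel_measurable M" "g \<in> borel_measurable M"
  shows "(\<lambda>x. H (f x) (g x)) \<in> borel_measurable M"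
proof -
  have "(\<lambda>p. H (fst p) (snd p)) \<in> borel_measurable borel"
    by (intro borel_measurable_continuous_onI continuous_intros)
  then have "(\<lambda>p. H (fst p) (snd p)) \<in> borel_measurable (borel \<Otimes>\<^sub>M borel)" by (simp add: borel_prod)
  from measurable_compose[OF measurable_Pair[OF assms] this] show ?thesis by simp
qed

lemma measurable_N [measurable (raw)]:
  assumes [measurable]: "f \<in> borel_measurable M"
  shows "(\<lambda>x. N (f x)) \<in> borel_measurable M"
  unfolding N_def by measurable

lemma N_add: "N (x + y) = N x + N y + 2 * Re (H x y)"
  using hermitian[of y x] by (simp add: N_def add_left add_right)

lemma N_diff: "N (x - y) = N x + N y - 2 * Re (H x y)"
  using hermitian[of y x] by (simp add: N_def diff_left diff_right)

lemma N_minus [simp]: "N (- x) = N x"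
  by (simp add: N_def minus_left minus_right)

lemma N_cscale: "N (cscale c x) = (cmod c)\<^sup>2 * N x"
proof -
  have "H (cscale c x) (cscale c x) = of_real ((cmod c)\<^sup>2) * of_real (N x)"
    by (simp only: cscale_left cscale_right H_diag[of x] mult.assoc[symmetric] complex_norm_square mult.commute)
  then show ?thesis by (simp only: N_def[of "cscale c x"] of_real_mult[symmetric] Re_complex_of_real)
qed

lemma N_scaleR: "N (r *\<^sub>R x) = r\<^sup>2 * N x"
  by (simp add: cscale_of_real[symmetric] N_cscale)

lemma N_ge: "m * (norm x)\<^sup>2 \<le> N x"
  using coercive by (simp add: N_def)

lemma N_nonneg [simp]: "0 \<le> N x"
  using N_ge[of x] m_pos by (smt (verit) mult_nonneg_nonneg zero_le_power2)

lemma integrable_exp_N: "a > 0 \<Longrightarrow> integrable lborel (\<lambda>x. exp (- a * N x))"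
  by (rule integrable_gauss_dominated[of "a * m" _ 1])
     (use N_ge m_pos in \<open>auto simp: mult.assoc\<close>)

lemma cn_holomorphic_H: "cn_holomorphic (\<lambda>x. H x y)"
  by (rule cn_holomorphic_linear[OF linear_left]) (rule cscale_left)

lemma cn_holomorphic_cmult_H: "cn_holomorphic (\<lambda>x. c * H x y)"
  by (intro cn_holomorphic_mult cn_holomorphic_const cn_holomorphic_H)

text \<open>Normalising constant of the reproducing formula. It remains an integral, of which only
  positivity is used, so no determinant of \<open>H\<close> appears.\<close>

definition mass where "mass = (\<integral>y. exp (- 2 * N y) \<partial>lborel)"

lemma mass_pos: "mass > 0"
proof -
  have "mass \<ge> 0" unfolding mass_def by simp
  moreover have "mass \<noteq> 0"
  proof
    assume "mass = 0"
    then have "AE y in lborel. exp (- 2 * N y) = 0"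
      unfolding mass_def using integral_nonneg_eq_0_iff_AE[OF integrable_exp_N[of 2]] by simp
    then have "AE y::complex^'n in lborel. False" by simp
    then have "emeasure lborel (UNIV :: (complex^'n) set) = 0"
      by (simp add: AE_iff_null null_sets_def)
    then show False by simp
  qed
  ultimately show ?thesis by simp
qed

text \<open>Recentring at \<open>x\<close> turns the exponent into
  \<open>- 2 * N s - 2 * H s x\<close>. The first term is invariant under the circle action, the
  second is holomorphic in \<open>s\<close> and vanishes at 0, so averaging over the action leaves
  \<open>\<phi> x\<close>. Integrability is the only growth condition, which admits both elements of
  the Bargmann space and exponentials.\<close>

lemma reproducing_formula:
  assumes \<phi>: "cn_holomorphic \<phi>"
    and int: "integrable lborel (\<lambda>y. exp (2 * H x y - of_real (2 * N y)) * \<phi> y)"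
  shows "(\<integral>y. exp (2 * H x y - of_real (2 * N y)) * \<phi> y \<partial>lborel) = of_real mass * \<phi> x"
proof -
  note [measurable] = cn_holomorphic_measurable[OF \<phi>]
  define \<psi> where "\<psi> = (\<lambda>s. exp (- 2 * H s x) * \<phi> (x + s))"
  have \<psi>: "cn_holomorphic \<psi>" unfolding \<psi>_def
    by (rule cn_holomorphic_mult[OF cn_holomorphic_exp[OF cn_holomorphic_cmult_H] cn_holomorphic_translate[OF \<phi>]])
  have eq: "exp (2 * H x (x + s) - of_real (2 * N (x + s))) * \<phi> (x + s) = exp (- 2 * N s) *\<^sub>R \<psi> s" for s
  proof -
    have "2 * H x (x + s) - of_real (2 * N (x + s)) = of_real (- 2 * N s) + (- 2 * H s x)"
      by (simp add: N_add add_right H_diag hermitian[of s x] complex_eq_iff)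
    then show ?thesis
      unfolding \<psi>_def by (simp only: exp_add exp_of_real scaleR_conv_of_real mult.assoc)
  qed
  have m: "(\<lambda>y. exp (2 * H x y - of_real (2 * N y)) * \<phi> y) \<in> borel_measurable borel" by measurable
  have "integrable lborel (\<lambda>s. exp (- 2 * N s) *\<^sub>R \<psi> s)"
    using int unfolding lborel_integrable_translate_iff[OF m, of x, symmetric] eq .
  then have "(\<integral>s. exp (- 2 * N s) *\<^sub>R \<psi> s \<partial>lborel) = (\<integral>s. exp (- 2 * N s) *\<^sub>R \<psi> 0 \<partial>lborel)"
    by (intro integral_entire_rotation_invariant[OF \<psi>]) (simp_all add: N_cscale)
  also have "\<dots> = mass *\<^sub>R \<phi> x"
    unfolding mass_def using integrable_exp_N[of 2] linear_0[OF linear_left[of x]]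
    by (simp add: \<psi>_def)
  finally show ?thesis
    unfolding lborel_integral_translate[OF m, of x, symmetric] eq by (simp add: scaleR_conv_of_real)
qed

text \<open>Differentiation under the integral with an explicit quadratic remainder. Integrability
  against every \<open>exp (C * norm y)\<close> absorbs the powers of \<open>norm y\<close> that
  differentiation brings down.\<close>

lemma cn_holomorphic_laplace:
  assumes [measurable]: "\<psi> \<in> borel_measurable borel"
    and int: "\<And>C. integrable lborel (\<lambda>y. exp (C * norm y) * cmod (\<psi> y))"
  shows "cn_holomorphic (\<lambda>x. \<integral>y. exp (2 * H x y) * \<psi> y \<partial>lborel)"
proof -
  obtain K where K: "K > 0" "\<And>x y. cmod (H x y) \<le> K * norm x * norm y" by (rule H_bound) blast
  have exp_le: "cmod (exp (2 * H x y)) \<le> exp (2 * K * norm x * norm y)" for x y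
  proof -
    have "Re (2 * H x y) \<le> 2 * cmod (H x y)" using complex_Re_le_cmod[of "H x y"] by simp
    then show ?thesis using K(2)[of x y] by simp
  qed
  have i0: "integrable lborel (\<lambda>y. exp (2 * H x y) * \<psi> y)" for x
  proof (rule Bochner_Integration.integrable_bound[OF int[of "2 * K * norm x"]])
    show "AE y in lborel. norm (exp (2 * H x y) * \<psi> y) \<le> norm (exp (2 * K * norm x * norm y) * cmod (\<psi> y))"
      using exp_le by (intro AE_I2) (simp add: norm_mult mult_right_mono del: norm_exp_eq_Re)
  qed simp
  have i1: "integrable lborel (\<lambda>y. 2 * H t y * (exp (2 * H x y) * \<psi> y))" for x t
  proof (rule Bochner_Integration.integrable_bound)
    show "integrable lborel (\<lambda>y. 2 * K * norm t * (exp ((2 * K * norm x + 1) * norm y) * cmod (\<psi> y)))"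
      by (intro integrable_mult_right int)
    have b: "norm (2 * H t y * (exp (2 * H x y) * \<psi> y))
        \<le> 2 * K * norm t * (exp ((2 * K * norm x + 1) * norm y) * cmod (\<psi> y))" for y
    proof -
      \<comment> \<open>Trading the linear factor for one more exponential keeps the majorant of the
        form covered by \<open>int\<close>.\<close>
      have "norm y \<le> exp (norm y)" using exp_ge_add_one_self[of "norm y"] by linarith
      then have "K * norm t * norm y \<le> K * norm t * exp (norm y)"
        using K(1) by (intro mult_left_mono) auto
      then have a: "cmod (2 * H t y) \<le> 2 * K * norm t * exp (norm y)"
        using K(2)[of t y] by (simp add: norm_mult)
      have "norm (2 * H t y * (exp (2 * H x y) * \<psi> y))
        \<le> (2 * K * norm t * exp (norm y)) * (exp (2 * K * norm x * norm y) * cmod (\<psi> y))"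
        unfolding norm_mult[of "2 * H t y"] norm_mult[of "exp _"]
        by (intro mult_mono a exp_le) (use K(1) in auto)
      also have "\<dots> = 2 * K * norm t * (exp ((2 * K * norm x + 1) * norm y) * cmod (\<psi> y))"
        by (simp add: distrib_right exp_add)
      finally show ?thesis .
    qed
    show "AE y in lborel. norm (2 * H t y * (exp (2 * H x y) * \<psi> y)) \<le>
      norm (2 * K * norm t * (exp ((2 * K * norm x + 1) * norm y) * cmod (\<psi> y)))"
      by (rule AE_I2, rule order_trans[OF b]) (simp only: real_norm_def abs_ge_self)
  qed simp
  define D where "D = (\<lambda>x t. \<integral>y. 2 * H t y * (exp (2 * H x y) * \<psi> y) \<partial>lborel)"
  have D_cscale: "D x (cscale c v) = c * D x v" for x c v
    unfolding D_def by (simp add: cscale_left mult.assoc mult.left_commute[of _ c])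
  have D_add: "D x (v + w) = D x v + D x w" for x v w
    unfolding D_def using i1[of v x] i1[of w x] by (simp add: add_left algebra_simps)
  have D_scaleR: "D x (r *\<^sub>R v) = r *\<^sub>R D x v" for x r v
    by (simp add: cscale_of_real[symmetric] D_cscale scaleR_conv_of_real)
  have D_lin: "bounded_linear (D x)" for x
    using linear_conv_bounded_linear linearI[of "D x"] D_add D_scaleR by blast
  define W where "W = (\<lambda>x. \<integral>y. exp (2 * H x y) * \<psi> y \<partial>lborel)"
  have "(W has_derivative D x) (at x)" for x
  proof -
    \<comment> \<open>The rate collects \<open>2 * K\<close> from the Taylor remainder with
      \<open>norm t \<le> 1\<close>, \<open>2 * K * norm x\<close> from
      \<open>exp (2 * H x y)\<close>, and 2 from bounding the square of \<open>norm y\<close> by an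
      exponential.\<close>
    define B where "B = (\<integral>y. exp ((2 * K + 2 * K * norm x + 2) * norm y) * cmod (\<psi> y) \<partial>lborel)"
    have B: "B \<ge> 0" unfolding B_def by simp
    have rem: "norm (W (x + t) - W x - D x t) \<le> 4 * K\<^sup>2 * B * (norm t)\<^sup>2" if t: "norm t \<le> 1" for t
    proof -
      have "W (x + t) - W x - D x t = (\<integral>y. exp (2 * H (x + t) y) * \<psi> y - exp (2 * H x y) * \<psi> y
          - 2 * H t y * (exp (2 * H x y) * \<psi> y) \<partial>lborel)"
        unfolding W_def D_def using i0 i1 by simp
      also have "norm \<dots> \<le> (\<integral>y. 4 * K\<^sup>2 * (norm t)\<^sup>2 * (exp ((2 * K + 2 * K * norm x + 2) * norm y) * cmod (\<psi> y)) \<partial>lborel)"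
      proof (rule Bochner_Integration.integral_norm_bound_integral)
        fix y
        let ?z = "2 * H t y"
        have z: "cmod ?z \<le> 2 * K * norm t * norm y" using K(2)[of t y] by (simp add: norm_mult)
        have "\<bar>Re ?z\<bar> \<le> 2 * K * norm t * norm y" using abs_Re_le_cmod[of ?z] z by linarith
        also have "\<dots> \<le> 2 * K * norm y"
          using t K(1) mult_left_mono[of "norm t" 1 "2 * K * norm y"] by (simp add: mult_ac)
        finally have r: "\<bar>Re ?z\<bar> \<le> 2 * K * norm y" .
        have y: "norm y \<le> exp (norm y)" using exp_ge_add_one_self[of "norm y"] by linarith
        have "(cmod ?z)\<^sup>2 \<le> (2 * K * norm t * norm y)\<^sup>2" using z by (intro power_mono) auto
        also have "\<dots> = 4 * K\<^sup>2 * (norm t)\<^sup>2 * (norm y)\<^sup>2" by (simp add: power_mult_distrib)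
        also have "\<dots> \<le> 4 * K\<^sup>2 * (norm t)\<^sup>2 * (exp (norm y))\<^sup>2"
          by (intro mult_left_mono power_mono y) auto
        finally have z2: "(cmod ?z)\<^sup>2 \<le> 4 * K\<^sup>2 * (norm t)\<^sup>2 * exp (2 * norm y)"
          by (simp add: power2_eq_square exp_add[symmetric])
        have "cmod (exp ?z - (1 + ?z)) \<le> exp \<bar>Re ?z\<bar> * (cmod ?z)\<^sup>2"
          using Taylor_exp[of ?z 1] by (simp add: numeral_2_eq_2)
        also have "\<dots> \<le> exp (2 * K * norm y) * (4 * K\<^sup>2 * (norm t)\<^sup>2 * exp (2 * norm y))"
          using r z2 by (intro mult_mono) auto
        finally have T: "cmod (exp ?z - (1 + ?z)) \<le> exp (2 * K * norm y) * (4 * K\<^sup>2 * (norm t)\<^sup>2 * exp (2 * norm y))" .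
        have "exp (2 * H (x + t) y) * \<psi> y - exp (2 * H x y) * \<psi> y - ?z * (exp (2 * H x y) * \<psi> y)
          = (exp ?z - (1 + ?z)) * (exp (2 * H x y) * \<psi> y)"
          by (simp add: add_left distrib_left exp_add algebra_simps)
        also have "norm \<dots> \<le> (exp (2 * K * norm y) * (4 * K\<^sup>2 * (norm t)\<^sup>2 * exp (2 * norm y)))
            * (exp (2 * K * norm x * norm y) * cmod (\<psi> y))"
          unfolding norm_mult[of "exp _ - _"] norm_mult[of "exp _" "\<psi> y"]
          by (intro mult_mono T exp_le) auto
        also have "\<dots> = 4 * K\<^sup>2 * (norm t)\<^sup>2 * (exp ((2 * K + 2 * K * norm x + 2) * norm y) * cmod (\<psi> y))"
          by (simp add: distrib_right exp_add)
        finally show "norm (exp (2 * H (x + t) y) * \<psi> y - exp (2 * H x y) * \<psi> y - ?z * (exp (2 * H x y) * \<psi> y))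
          \<le> 4 * K\<^sup>2 * (norm t)\<^sup>2 * (exp ((2 * K + 2 * K * norm x + 2) * norm y) * cmod (\<psi> y))" .
      qed (use i0 i1 int in auto)
      also have "\<dots> = 4 * K\<^sup>2 * B * (norm t)\<^sup>2" unfolding B_def by simp
      finally show ?thesis .
    qed
    have "((\<lambda>t. norm (W (x + t) - W x - D x t) / norm t) \<longlongrightarrow> 0) (at 0)"
    proof (rule real_tendsto_sandwich)
      show "\<forall>\<^sub>F t in at 0. 0 \<le> norm (W (x + t) - W x - D x t) / norm t" by simp
      show "\<forall>\<^sub>F t in at 0. norm (W (x + t) - W x - D x t) / norm t \<le> 4 * K\<^sup>2 * B * norm t"
        unfolding eventually_at
      proof (intro exI[of _ 1] conjI ballI impI)
        fix t :: "complex ^ 'n" assume t: "t \<noteq> 0 \<and> dist t 0 < 1"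
        then have "norm (W (x + t) - W x - D x t) / norm t \<le> 4 * K\<^sup>2 * B * (norm t)\<^sup>2 / norm t"
          by (intro divide_right_mono rem) auto
        then show "norm (W (x + t) - W x - D x t) / norm t \<le> 4 * K\<^sup>2 * B * norm t"
          using t by (simp add: power2_eq_square)
      qed simp
      show "((\<lambda>t. 4 * K\<^sup>2 * B * norm t) \<longlongrightarrow> 0) (at 0)"
        by (intro tendsto_eq_intros) auto
    qed simp
    then show ?thesis using D_lin by (simp add: has_derivative_at)
  qed
  then show ?thesis unfolding W_def[symmetric] by (rule cn_holomorphicI) (rule D_cscale)
qed

end

section \<open>The Bergman projection\<close>

lemma abs_mult_le_sum_squares: "\<bar>a * b\<bar> \<le> a\<^sup>2 + (b::real)\<^sup>2"
proof -
  have "0 \<le> \<bar>a\<bar> * \<bar>b\<bar>" by simp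
  then show ?thesis using sum_squares_bound[of "\<bar>a\<bar>" "\<bar>b\<bar>"] unfolding abs_mult power2_abs by linarith
qed

lemma borel_measurable_cnj [measurable (raw)]:
  assumes [measurable]: "g \<in> borel_measurable M"
  shows "(\<lambda>x. cnj (g x)) \<in> borel_measurable M"
proof -
  have "cnj \<in> borel_measurable borel"
    by (intro borel_measurable_continuous_onI continuous_intros)
  from measurable_compose[OF assms this] show ?thesis .
qed

lemma integrable_mult_L2:
  fixes f g :: "'a \<Rightarrow> real"
  assumes [measurable]: "f \<in> borel_measurable M" "g \<in> borel_measurable M"
    and "integrable M (\<lambda>x. (f x)\<^sup>2)" "integrable M (\<lambda>x. (g x)\<^sup>2)"
  shows "integrable M (\<lambda>x. f x * g x)"
proof (rule Bochner_Integration.integrable_bound)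
  show "integrable M (\<lambda>x. (f x)\<^sup>2 + (g x)\<^sup>2)" using assms by simp
  have "\<bar>f x * g x\<bar> \<le> (f x)\<^sup>2 + (g x)\<^sup>2" for x
    by (rule abs_mult_le_sum_squares)
  then show "AE x in M. norm (f x * g x) \<le> norm ((f x)\<^sup>2 + (g x)\<^sup>2)" by simp
qed simp

text \<open>The bound of \<open>F x * G y\<close> by the sum of the two squares separates the
  variables, so each term meets only one marginal integral of the kernel. This supplies the Fubini
  hypothesis for the orthogonality of the projection and for the Toeplitz kernel.\<close>

lemma integrable_kernel_L2:
  fixes \<kappa> :: "'a \<Rightarrow> 'b \<Rightarrow> real"
  assumes "sigma_finite_measure M" "sigma_finite_measure N"
  assumes [measurable]: "case_prod \<kappa> \<in> borel_measurable (M \<Otimes>\<^sub>M N)" "F \<in> borel_measurable M" "G \<in> borel_measurable N"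
    and \<kappa>: "\<And>x y. 0 \<le> \<kappa> x y"
    and A: "\<And>x. (\<integral>\<^sup>+y. ennreal (\<kappa> x y) \<partial>N) \<le> ennreal A" and B: "\<And>y. (\<integral>\<^sup>+x. ennreal (\<kappa> x y) \<partial>M) \<le> ennreal B"
    and F: "integrable M (\<lambda>x. (F x)\<^sup>2)" and G: "integrable N (\<lambda>y. (G y)\<^sup>2)"
  shows "integrable (M \<Otimes>\<^sub>M N) (\<lambda>(x, y). \<kappa> x y * (F x * G y))"
proof -
  interpret M: sigma_finite_measure M by fact
  interpret N: sigma_finite_measure N by fact
  interpret pair_sigma_finite M N ..
  have "(\<integral>\<^sup>+z. ennreal (norm (case z of (x, y) \<Rightarrow> \<kappa> x y * (F x * G y))) \<partial>(M \<Otimes>\<^sub>M N))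
    \<le> (\<integral>\<^sup>+(x, y). ennreal (\<kappa> x y) * ennreal ((F x)\<^sup>2) + ennreal (\<kappa> x y) * ennreal ((G y)\<^sup>2) \<partial>(M \<Otimes>\<^sub>M N))"
  proof (rule nn_integral_mono, clarify)
    fix x y
    have "\<bar>F x * G y\<bar> \<le> (F x)\<^sup>2 + (G y)\<^sup>2"
      by (rule abs_mult_le_sum_squares)
    then have "norm (\<kappa> x y * (F x * G y)) \<le> \<kappa> x y * ((F x)\<^sup>2 + (G y)\<^sup>2)"
      unfolding norm_mult[of "\<kappa> x y"] using \<kappa>[of x y] by (simp add: mult_left_mono)
    then show "ennreal (norm (\<kappa> x y * (F x * G y)))
        \<le> ennreal (\<kappa> x y) * ennreal ((F x)\<^sup>2) + ennreal (\<kappa> x y) * ennreal ((G y)\<^sup>2)"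
      using \<kappa>[of x y] by (simp add: ennreal_mult[symmetric] ennreal_plus[symmetric] distrib_left ennreal_leI del: ennreal_plus)
  qed
  also have "\<dots> = (\<integral>\<^sup>+(x, y). ennreal (\<kappa> x y) * ennreal ((F x)\<^sup>2) \<partial>(M \<Otimes>\<^sub>M N))
      + (\<integral>\<^sup>+(x, y). ennreal (\<kappa> x y) * ennreal ((G y)\<^sup>2) \<partial>(M \<Otimes>\<^sub>M N))"
    unfolding split_beta by (rule nn_integral_add) measurable
  also have "(\<integral>\<^sup>+(x, y). ennreal (\<kappa> x y) * ennreal ((F x)\<^sup>2) \<partial>(M \<Otimes>\<^sub>M N))
      = (\<integral>\<^sup>+x. (\<integral>\<^sup>+y. ennreal (\<kappa> x y) \<partial>N) * ennreal ((F x)\<^sup>2) \<partial>M)"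
    by (subst N.nn_integral_fst[symmetric], measurable)
       (auto intro!: nn_integral_cong nn_integral_multc)
  also have "\<dots> \<le> (\<integral>\<^sup>+x. ennreal A * ennreal ((F x)\<^sup>2) \<partial>M)"
    by (intro nn_integral_mono mult_right_mono A) simp
  also have "(\<integral>\<^sup>+(x, y). ennreal (\<kappa> x y) * ennreal ((G y)\<^sup>2) \<partial>(M \<Otimes>\<^sub>M N))
      = (\<integral>\<^sup>+y. (\<integral>\<^sup>+x. ennreal (\<kappa> x y) \<partial>M) * ennreal ((G y)\<^sup>2) \<partial>N)"
    by (subst nn_integral_snd[symmetric], measurable)
       (auto intro!: nn_integral_cong nn_integral_multc)
  also have "\<dots> \<le> (\<integral>\<^sup>+y. ennreal B * ennreal ((G y)\<^sup>2) \<partial>N)"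
    by (intro nn_integral_mono mult_right_mono B) simp
  also have "(\<integral>\<^sup>+x. ennreal A * ennreal ((F x)\<^sup>2) \<partial>M) + (\<integral>\<^sup>+y. ennreal B * ennreal ((G y)\<^sup>2) \<partial>N) < \<infinity>"
    using F G by (simp add: nn_integral_cmult integrable_iff_bounded ennreal_mult_less_top)
  finally show ?thesis
    unfolding integrable_iff_bounded by (simp add: add_mono)
qed

section \<open>The weighted L2 space and its Bergman kernel\<close>

locale bargmann_weight = hermitian_form H m
  for H :: "complex ^ 'n \<Rightarrow> complex ^ 'n \<Rightarrow> complex" and m :: real +
  fixes f :: "complex ^ 'n \<Rightarrow> complex" and \<Phi> :: "complex ^ 'n \<Rightarrow> real"
  assumes f: "cn_holomorphic f" and \<Phi>_eq: "\<And>x. \<Phi> x = N x + Re (f x)"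
begin

lemma measurable_f [measurable]: "f \<in> borel_measurable borel"
  using f by (rule cn_holomorphic_measurable)

lemma measurable_\<Phi> [measurable]: "\<Phi> \<in> borel_measurable borel"
  unfolding \<Phi>_eq by measurable

text \<open>The Bergman kernel without the factor \<open>1 / mass\<close>: the polarisation of
  \<open>exp (2 * \<Phi> x)\<close>, holomorphic in \<open>x\<close> and antiholomorphic in
  \<open>y\<close>.\<close>

definition kern where "kern x y = exp (f x + cnj (f y) + 2 * H x y)"

lemma measurable_kern [measurable (raw)]:
  assumes [measurable]: "g \<in> borel_measurable M" "h \<in> borel_measurable M"
  shows "(\<lambda>x. kern (g x) (h x)) \<in> borel_measurable M"
  unfolding kern_def by measurable

text \<open>Once the weights are divided out, the holomorphic part \<open>f\<close> disappears and a
  translation-invariant Gaussian remains. All L2 estimates for the projection rest on this.\<close>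

lemma cmod_kern: "cmod (kern x y) = exp (\<Phi> x) * exp (\<Phi> y) * exp (- N (x - y))"
  by (simp add: kern_def \<Phi>_eq N_diff exp_add[symmetric])

lemma cnj_kern: "cnj (kern x y) = kern y x"
  by (simp add: kern_def exp_cnj hermitian[of x y] add_ac)

lemma kern_weight: "kern x y * of_real (exp (- 2 * \<Phi> y)) = exp (f x) * (exp (2 * H x y - of_real (2 * N y)) * exp (- f y))"
proof -
  have "f x + cnj (f y) + 2 * H x y + of_real (- 2 * \<Phi> y) = f x + ((2 * H x y - of_real (2 * N y)) + (- f y))"
    by (simp add: \<Phi>_eq complex_eq_iff)
  then show ?thesis
    unfolding kern_def exp_of_real[symmetric] exp_add[symmetric] by (rule arg_cong)
qed

text \<open>Moves the weight onto the function, so that weighted L2 norms become plain ones and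
  kernel estimates become convolution estimates.\<close>

definition red where "red u x = exp (- \<Phi> x) * cmod (u x)"

lemma red_nonneg [simp]: "red u x \<ge> 0" by (simp add: red_def)

lemma measurable_red [measurable]: "u \<in> borel_measurable borel \<Longrightarrow> red u \<in> borel_measurable borel"
  unfolding red_def by measurable

lemma red_sq: "(red u x)\<^sup>2 = exp (- 2 * \<Phi> x) * (cmod (u x))\<^sup>2"
  by (simp add: red_def power_mult_distrib exp_double[symmetric])

lemma wL2_iff: "u \<in> wL2 \<Phi> \<longleftrightarrow> u \<in> borel_measurable borel \<and> integrable lborel (\<lambda>x. (red u x)\<^sup>2)"
proof -
  have "integrable (weighted_measure \<Phi>) (\<lambda>x. (cmod (u x))\<^sup>2) \<longleftrightarrow> integrable lborel (\<lambda>x. (red u x)\<^sup>2)"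
    if [measurable]: "u \<in> borel_measurable borel"
    unfolding weighted_measure_def red_sq by (subst integrable_density) auto
  then show ?thesis by (auto simp: wL2_def)
qed

lemma wnorm_eq:
  assumes [measurable]: "u \<in> borel_measurable borel"
  shows "wnorm \<Phi> u = sqrt (\<integral>x. (red u x)\<^sup>2 \<partial>lborel)"
  unfolding wnorm_def weighted_measure_def red_sq by (subst integral_density) auto

lemma winner_eq:
  assumes [measurable]: "u \<in> borel_measurable borel" "v \<in> borel_measurable borel"
  shows "winner \<Phi> u v = (\<integral>x. of_real (exp (- 2 * \<Phi> x)) * (u x * cnj (v x)) \<partial>lborel)"
  unfolding winner_def weighted_measure_def by (subst integral_density) (auto simp: scaleR_conv_of_real)

lemma integrable_winner:
  assumes "u \<in> wL2 \<Phi>" "v \<in> wL2 \<Phi>"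
  shows "integrable lborel (\<lambda>x. of_real (exp (- 2 * \<Phi> x)) * (u x * cnj (v x)))"
proof (rule Bochner_Integration.integrable_bound)
  from assms have [measurable]: "u \<in> borel_measurable borel" "v \<in> borel_measurable borel"
    by (auto simp: wL2_iff)
  show "integrable lborel (\<lambda>x. red u x * red v x)"
    using assms by (intro integrable_mult_L2) (auto simp: wL2_iff)
  show "AE x in lborel. norm (of_real (exp (- 2 * \<Phi> x)) * (u x * cnj (v x))) \<le> norm (red u x * red v x)"
    by (simp add: red_def norm_mult exp_minus_inverse abs_mult mult_exp_exp[symmetric] mult_ac flip: exp_double exp_add)
  show "(\<lambda>x. of_real (exp (- 2 * \<Phi> x)) * (u x * cnj (v x))) \<in> borel_measurable lborel" by measurable
qed

lemma winner_diff:
  assumes "u \<in> wL2 \<Phi>" "v \<in> wL2 \<Phi>" "h \<in> wL2 \<Phi>"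
  shows "winner \<Phi> (\<lambda>x. u x - v x) h = winner \<Phi> u h - winner \<Phi> v h"
proof -
  from assms have m: "u \<in> borel_measurable borel" "v \<in> borel_measurable borel" "h \<in> borel_measurable borel"
    by (auto simp: wL2_iff)
  show ?thesis
    using integrable_winner[OF assms(1,3)] integrable_winner[OF assms(2,3)]
    unfolding winner_eq[OF borel_measurable_diff[OF m(1,2)] m(3)] winner_eq[OF m(1,3)] winner_eq[OF m(2,3)]
      left_diff_distrib right_diff_distrib
    by (rule Bochner_Integration.integral_diff)
qed

lemma wL2_diff:
  assumes "u \<in> wL2 \<Phi>" "v \<in> wL2 \<Phi>"
  shows "(\<lambda>x. u x - v x) \<in> wL2 \<Phi>"
proof -
  from assms have [measurable]: "u \<in> borel_measurable borel" "v \<in> borel_measurable borel"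
    by (auto simp: wL2_iff)
  have "integrable lborel (\<lambda>x. (red (\<lambda>x. u x - v x) x)\<^sup>2)"
  proof (rule Bochner_Integration.integrable_bound)
    show "integrable lborel (\<lambda>x. 2 * (red u x)\<^sup>2 + 2 * (red v x)\<^sup>2)"
      using assms by (auto simp: wL2_iff)
    have "(red (\<lambda>x. u x - v x) x)\<^sup>2 \<le> 2 * (red u x)\<^sup>2 + 2 * (red v x)\<^sup>2" for x
    proof -
      have "red (\<lambda>x. u x - v x) x \<le> red u x + red v x"
        unfolding red_def distrib_left[symmetric] by (intro mult_left_mono norm_triangle_ineq4) simp
      then have "(red (\<lambda>x. u x - v x) x)\<^sup>2 \<le> (red u x + red v x)\<^sup>2"
        by (intro power_mono) auto
      also have "\<dots> \<le> 2 * (red u x)\<^sup>2 + 2 * (red v x)\<^sup>2"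
        using sum_squares_bound[of "red u x" "red v x"] by (simp add: power2_sum)
      finally show ?thesis .
    qed
    then show "AE x in lborel. norm ((red (\<lambda>x. u x - v x) x)\<^sup>2) \<le> norm (2 * (red u x)\<^sup>2 + 2 * (red v x)\<^sup>2)"
      by simp
  qed simp
  then show ?thesis by (simp add: wL2_iff)
qed

text \<open>Schur's test carried over to the weighted space. Since the domination \<open>w\<close>
  is between extended nonnegative quantities, membership and norm bound come out together; the first
  serves the projection, the second the Toeplitz operator.\<close>

lemma wL2_integral_operator:
  fixes \<kappa> :: "complex ^ 'n \<Rightarrow> complex ^ 'n \<Rightarrow> real"
  assumes v: "v \<in> wL2 \<Phi>" and [measurable]: "w \<in> borel_measurable borel"
    and [measurable]: "case_prod \<kappa> \<in> borel_measurable (borel \<Otimes>\<^sub>M borel)"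
    and \<kappa>: "\<And>x y. 0 \<le> \<kappa> x y"
    and A: "\<And>x. (\<integral>\<^sup>+y. ennreal (\<kappa> x y) \<partial>lborel) \<le> ennreal A"
    and B: "\<And>y. (\<integral>\<^sup>+x. ennreal (\<kappa> x y) \<partial>lborel) \<le> ennreal B" and "A \<ge> 0" "B \<ge> 0"
    and w: "\<And>x. ennreal (red w x) \<le> (\<integral>\<^sup>+y. ennreal (\<kappa> x y) * ennreal (red v y) \<partial>lborel)"
  shows "w \<in> wL2 \<Phi>" "wnorm \<Phi> w \<le> sqrt (A * B) * wnorm \<Phi> v"
proof -
  from v have [measurable]: "v \<in> borel_measurable borel" and iv: "integrable lborel (\<lambda>x. (red v x)\<^sup>2)"
    by (auto simp: wL2_iff)
  have "(\<integral>\<^sup>+x. ennreal ((red w x)\<^sup>2) \<partial>lborel) = (\<integral>\<^sup>+x. (ennreal (red w x))\<^sup>2 \<partial>lborel)"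
    by (simp add: ennreal_power)
  also have "\<dots> \<le> (\<integral>\<^sup>+x. (\<integral>\<^sup>+y. ennreal (\<kappa> x y) * ennreal (red v y) \<partial>lborel)\<^sup>2 \<partial>lborel)"
    by (intro nn_integral_mono power_mono w) simp
  also have "\<dots> \<le> ennreal A * ennreal B * (\<integral>\<^sup>+y. (ennreal (red v y))\<^sup>2 \<partial>lborel)"
    by (rule schur_test[OF sigma_finite_lborel sigma_finite_lborel]) (use A B in auto)
  also have "\<dots> = ennreal (A * B * (\<integral>y. (red v y)\<^sup>2 \<partial>lborel))"
    using iv \<open>A \<ge> 0\<close> \<open>B \<ge> 0\<close> by (simp add: ennreal_power nn_integral_eq_integral ennreal_mult)
  finally have *: "(\<integral>\<^sup>+x. ennreal ((red w x)\<^sup>2) \<partial>lborel) \<le> ennreal (A * B * (\<integral>y. (red v y)\<^sup>2 \<partial>lborel))" .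
  then have iw: "integrable lborel (\<lambda>x. (red w x)\<^sup>2)"
    by (simp add: integrable_iff_bounded le_less_trans[OF _ ennreal_less_top])
  then show "w \<in> wL2 \<Phi>" by (simp add: wL2_iff)
  have "(\<integral>x. (red w x)\<^sup>2 \<partial>lborel) \<le> A * B * (\<integral>y. (red v y)\<^sup>2 \<partial>lborel)"
    using * \<open>A \<ge> 0\<close> \<open>B \<ge> 0\<close> by (simp add: nn_integral_eq_integral[OF iw] ennreal_le_iff)
  then have "sqrt (\<integral>x. (red w x)\<^sup>2 \<partial>lborel) \<le> sqrt (A * B * (\<integral>y. (red v y)\<^sup>2 \<partial>lborel))"
    by (rule real_sqrt_le_mono)
  then show "wnorm \<Phi> w \<le> sqrt (A * B) * wnorm \<Phi> v"
    by (simp add: wnorm_eq real_sqrt_mult)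
qed

definition gint where "gint = (\<integral>x. exp (- N x) \<partial>lborel)"

lemma nn_integral_exp_N_shift:
  "(\<integral>\<^sup>+y. ennreal (exp (- N (x - y))) \<partial>lborel) = ennreal gint"
  "(\<integral>\<^sup>+x. ennreal (exp (- N (x - y))) \<partial>lborel) = ennreal gint"
proof -
  have i: "integrable lborel (\<lambda>x. exp (- N x))" using integrable_exp_N[of 1] by simp
  have *: "(\<integral>\<^sup>+x. ennreal (exp (- N (x - y))) \<partial>lborel) = ennreal gint" for y
    unfolding gint_def nn_integral_lborel_diff[of "\<lambda>x. ennreal (exp (- N x))" y, simplified]
    by (rule nn_integral_eq_integral[OF i]) simp
  show "(\<integral>\<^sup>+x. ennreal (exp (- N (x - y))) \<partial>lborel) = ennreal gint" by (rule *)
  have "N (x - y) = N (y - x)" for y using N_minus[of "x - y"] by simp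
  then show "(\<integral>\<^sup>+y. ennreal (exp (- N (x - y))) \<partial>lborel) = ennreal gint" by (simp add: *)
qed

lemma gint_nonneg: "gint \<ge> 0" by (simp add: gint_def)

lemma integrable_exp_N_shift_sq: "integrable lborel (\<lambda>y. (exp (- N (x - y)))\<^sup>2)"
proof -
  have "integrable lborel (\<lambda>y. exp (- 2 * N (-x + y)))"
    using lborel_integrable_translate_iff[of "\<lambda>y. exp (- 2 * N y)" "-x"] integrable_exp_N[of 2] by simp
  moreover have "N (-x + y) = N (x - y)" for y using N_minus[of "x - y"] by simp
  ultimately show ?thesis by (simp add: exp_double[symmetric])
qed

lemma cmod_kern_integrand:
  "cmod (kern x y * v y * of_real (exp (- 2 * \<Phi> y))) = exp (\<Phi> x) * (exp (- N (x - y)) * red v y)"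
  by (simp add: norm_mult cmod_kern red_def exp_add[symmetric] mult_ac)

lemma integrable_kern:
  assumes "v \<in> wL2 \<Phi>"
  shows "integrable lborel (\<lambda>y. kern x y * v y * of_real (exp (- 2 * \<Phi> y)))"
proof (rule Bochner_Integration.integrable_bound)
  from assms have [measurable]: "v \<in> borel_measurable borel" by (auto simp: wL2_iff)
  show "integrable lborel (\<lambda>y. exp (\<Phi> x) * (exp (- N (x - y)) * red v y))"
    by (intro integrable_mult_right integrable_mult_L2 integrable_exp_N_shift_sq)
       (use assms in \<open>auto simp: wL2_iff\<close>)
  show "AE y in lborel. norm (kern x y * v y * of_real (exp (- 2 * \<Phi> y))) \<le> norm (exp (\<Phi> x) * (exp (- N (x - y)) * red v y))"
    by (simp only: cmod_kern_integrand) simp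
  show "(\<lambda>y. kern x y * v y * of_real (exp (- 2 * \<Phi> y))) \<in> borel_measurable lborel" by measurable
qed

definition proj where "proj v x = (\<integral>y. kern x y * v y * of_real (exp (- 2 * \<Phi> y)) \<partial>lborel) / of_real mass"

text \<open>Division of \<open>u\<close> by \<open>exp (f y)\<close> replaces the weight
  \<open>\<Phi>\<close> by \<open>N\<close>, which has the circle invariance behind the reproducing
  formula.\<close>

lemma reproducing_kern:
  assumes "u \<in> bargmann_space \<Phi>"
  shows "(\<integral>y. kern x y * u y * of_real (exp (- 2 * \<Phi> y)) \<partial>lborel) = of_real mass * u x"
proof -
  from assms have u: "cn_holomorphic u" "u \<in> wL2 \<Phi>" by (auto simp: bargmann_space_def)
  define \<phi> where "\<phi> = (\<lambda>y. exp (- 1 * f y) * u y)"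
  have \<phi>: "cn_holomorphic \<phi>" unfolding \<phi>_def
    by (intro cn_holomorphic_mult cn_holomorphic_exp f u) (rule cn_holomorphic_const)
  have eq: "kern x y * u y * of_real (exp (- 2 * \<Phi> y)) = exp (f x) * (exp (2 * H x y - of_real (2 * N y)) * \<phi> y)" for y
  proof -
    have "kern x y * u y * of_real (exp (- 2 * \<Phi> y)) = (kern x y * of_real (exp (- 2 * \<Phi> y))) * u y"
      by (simp only: mult_ac)
    then show ?thesis unfolding kern_weight \<phi>_def by (simp add: mult.assoc)
  qed
  have "integrable lborel (\<lambda>y. exp (2 * H x y - of_real (2 * N y)) * \<phi> y)"
    using integrable_mult_right[OF integrable_kern[OF u(2), of x, unfolded eq], of "exp (- f x)"]
    by (simp add: mult.assoc[symmetric] mult_exp_exp del: of_real_mult)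
  from reproducing_formula[OF \<phi> this] show ?thesis
    unfolding eq by (simp add: \<phi>_def exp_minus)
qed

lemma red_proj_le:
  assumes "v \<in> wL2 \<Phi>"
  shows "ennreal (red (proj v) x) \<le> (\<integral>\<^sup>+y. ennreal (exp (- N (x - y)) / mass) * ennreal (red v y) \<partial>lborel)"
proof -
  let ?I = "\<lambda>y. kern x y * v y * of_real (exp (- 2 * \<Phi> y))"
  have "ennreal (red (proj v) x) = ennreal (exp (- \<Phi> x) / mass) * ennreal (cmod (\<integral>y. ?I y \<partial>lborel))"
    using mass_pos by (simp add: red_def proj_def norm_divide ennreal_mult[symmetric])
  also have "\<dots> \<le> ennreal (exp (- \<Phi> x) / mass) * (\<integral>\<^sup>+y. ennreal (cmod (?I y)) \<partial>lborel)"
    by (intro mult_left_mono integral_norm_bound_ennreal integrable_kern assms) simp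
  also have "\<dots> = (\<integral>\<^sup>+y. ennreal (exp (- \<Phi> x) / mass) * ennreal (cmod (?I y)) \<partial>lborel)"
    using assms by (intro nn_integral_cmult[symmetric]) (auto simp: wL2_iff)
  also have "\<dots> = (\<integral>\<^sup>+y. ennreal (exp (- N (x - y)) / mass) * ennreal (red v y) \<partial>lborel)"
    using mass_pos by (simp only: cmod_kern_integrand) (simp add: ennreal_mult[symmetric] exp_minus field_simps)
  finally show ?thesis .
qed

text \<open>The variable \<open>x\<close> enters only through \<open>exp (f x)\<close> and
  \<open>exp (2 * H x y)\<close>. What is left is a Gaussian times \<open>red v\<close>, a product
  of two square integrable functions even after multiplication by
  \<open>exp (C * norm y)\<close>.\<close>

lemma cn_holomorphic_proj:
  assumes "v \<in> wL2 \<Phi>"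
  shows "cn_holomorphic (proj v)"
proof -
  from assms have [measurable]: "v \<in> borel_measurable borel" by (auto simp: wL2_iff)
  define \<psi> where "\<psi> = (\<lambda>y. exp (cnj (f y) + of_real (- 2 * \<Phi> y)) * v y)"
  have [measurable]: "\<psi> \<in> borel_measurable borel" unfolding \<psi>_def by measurable
  have "proj v = (\<lambda>x. (exp (f x) / of_real mass) * (\<integral>y. exp (2 * H x y) * \<psi> y \<partial>lborel))"
  proof
    fix x
    have "kern x y * v y * of_real (exp (- 2 * \<Phi> y)) = exp (f x) * (exp (2 * H x y) * \<psi> y)" for y
      unfolding kern_def \<psi>_def exp_of_real[symmetric] exp_add by (simp add: mult_ac)
    then show "proj v x = (exp (f x) / of_real mass) * (\<integral>y. exp (2 * H x y) * \<psi> y \<partial>lborel)"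
      by (simp add: proj_def)
  qed
  moreover have "cn_holomorphic (\<lambda>x. \<integral>y. exp (2 * H x y) * \<psi> y \<partial>lborel)"
  proof (rule cn_holomorphic_laplace)
    fix C :: real
    have "integrable lborel (\<lambda>y. exp (C * norm y - N y) * red v y)"
    proof (rule integrable_mult_L2)
      show "integrable lborel (\<lambda>y. (exp (C * norm y - N y))\<^sup>2)"
      proof (rule integrable_gauss_dominated[OF m_pos])
        fix y :: "complex ^ 'n"
        \<comment> \<open>Completing the square spends half of the coercivity of
          \<open>2 * N y\<close> on the linear exponent; the other half remains as the Gaussian
          majorant.\<close>
        have "0 \<le> (m * norm y - C)\<^sup>2 / m" using m_pos by simp
        also have "\<dots> = m * (norm y)\<^sup>2 - 2 * C * norm y + C\<^sup>2 / m"
          using m_pos by (simp add: power2_eq_square field_simps)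
        finally have "2 * (C * norm y - N y) \<le> C\<^sup>2 / m - m * (norm y)\<^sup>2" using N_ge[of y] by simp
        then show "norm ((exp (C * norm y - N y))\<^sup>2) \<le> exp (C\<^sup>2 / m) * exp (- m * (norm y)\<^sup>2)"
          by (simp add: exp_double[symmetric] exp_add[symmetric])
      qed simp
    qed (use assms in \<open>auto simp: wL2_iff\<close>)
    moreover have "exp (C * norm y) * cmod (\<psi> y) = exp (C * norm y - N y) * red v y" for y
      unfolding \<psi>_def red_def by (simp add: norm_mult \<Phi>_eq exp_add[symmetric] flip: mult.assoc)
    ultimately show "integrable lborel (\<lambda>y. exp (C * norm y) * cmod (\<psi> y))" by simp
  qed simp
  ultimately show ?thesis
    using cn_holomorphic_mult[OF cn_holomorphic_mult[OF cn_holomorphic_exp[OF f] cn_holomorphic_const[of "1 / of_real mass"]]]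
    by simp
qed

lemma proj_bargmann:
  assumes "v \<in> wL2 \<Phi>"
  shows "proj v \<in> bargmann_space \<Phi>"
proof -
  note [measurable] = cn_holomorphic_measurable[OF cn_holomorphic_proj[OF assms]]
  have s: "(\<integral>\<^sup>+y. ennreal (exp (- N (x - y)) / mass) \<partial>lborel) \<le> ennreal (gint / mass)"
    "(\<integral>\<^sup>+y. ennreal (exp (- N (y - x)) / mass) \<partial>lborel) \<le> ennreal (gint / mass)" for x
    using mass_pos gint_nonneg
    by (simp_all add: divide_ennreal[symmetric] nn_integral_divide nn_integral_exp_N_shift)
  have "proj v \<in> wL2 \<Phi>"
    by (rule wL2_integral_operator(1)[OF assms _ _ _ s _ _ red_proj_le[OF assms]])
       (use mass_pos gint_nonneg in auto)
  then show ?thesis by (simp add: bargmann_space_def cn_holomorphic_proj[OF assms])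
qed

text \<open>The Hermitian symmetry of the kernel moves the operator onto \<open>h\<close>, which it
  reproduces; hence \<open>v\<close> and \<open>proj v\<close> have the same inner product with
  \<open>h\<close>.\<close>

lemma proj_orthogonal:
  assumes v: "v \<in> wL2 \<Phi>" and h: "h \<in> bargmann_space \<Phi>"
  shows "winner \<Phi> (\<lambda>x. v x - proj v x) h = 0"
proof -
  have w: "proj v \<in> wL2 \<Phi>" using proj_bargmann[OF v] by (simp add: bargmann_space_def)
  from h have h2: "h \<in> wL2 \<Phi>" by (simp add: bargmann_space_def)
  from v w h2 have [measurable]: "v \<in> borel_measurable borel" "proj v \<in> borel_measurable borel"
      "h \<in> borel_measurable borel"
    by (auto simp: wL2_iff)
  let ?e = "\<lambda>x. of_real (exp (- 2 * \<Phi> x)) :: complex"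
  let ?F = "\<lambda>x y. (?e x * cnj (h x)) * (kern x y * v y * ?e y)"
  have i: "integrable (lborel \<Otimes>\<^sub>M lborel) (\<lambda>(x, y). ?F x y)"
  proof (rule Bochner_Integration.integrable_bound)
    show "integrable (lborel \<Otimes>\<^sub>M lborel) (\<lambda>(x, y). exp (- N (x - y)) * (red h x * red v y))"
      by (rule integrable_kernel_L2[OF sigma_finite_lborel sigma_finite_lborel _ _ _ _
            eq_refl[OF nn_integral_exp_N_shift(1)] eq_refl[OF nn_integral_exp_N_shift(2)]])
         (use v h2 in \<open>auto simp: wL2_iff\<close>)
    have "norm (?F x y) = exp (- N (x - y)) * (red h x * red v y)" for x y
      unfolding norm_mult[of "?e x * cnj (h x)"] cmod_kern_integrand
      by (simp add: norm_mult red_def mult_ac flip: exp_add)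
    then show "AE z in lborel \<Otimes>\<^sub>M lborel. norm (case z of (x, y) \<Rightarrow> ?F x y)
        \<le> norm (case z of (x, y) \<Rightarrow> exp (- N (x - y)) * (red h x * red v y))"
      by (auto intro!: AE_I2)
    show "(\<lambda>(x, y). ?F x y) \<in> borel_measurable (lborel \<Otimes>\<^sub>M lborel)"
      unfolding split_beta by measurable
  qed
  have inner: "(\<integral>y. ?F x y \<partial>lborel) = of_real mass * (?e x * (proj v x * cnj (h x)))" for x
    unfolding integral_mult_right_zero proj_def using mass_pos by simp
  have "winner \<Phi> (proj v) h = (\<integral>x. (\<integral>y. ?F x y \<partial>lborel) \<partial>lborel) / of_real mass"
    unfolding winner_eq[OF \<open>proj v \<in> borel_measurable borel\<close> \<open>h \<in> borel_measurable borel\<close>] inner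
    using mass_pos by simp
  also have "(\<integral>x. (\<integral>y. ?F x y \<partial>lborel) \<partial>lborel) = (\<integral>y. (\<integral>x. ?F x y \<partial>lborel) \<partial>lborel)"
    by (rule lborel_pair.Fubini_integral[OF i, symmetric])
  also have "\<dots> = (\<integral>y. of_real mass * (?e y * (v y * cnj (h y))) \<partial>lborel)"
  proof (rule Bochner_Integration.integral_cong[OF refl])
    fix y
    have "(\<integral>x. ?F x y \<partial>lborel) = (\<integral>x. (v y * ?e y) * cnj (kern y x * h x * ?e x) \<partial>lborel)"
      by (rule Bochner_Integration.integral_cong[OF refl]) (simp add: cnj_kern mult_ac)
    also have "\<dots> = (v y * ?e y) * cnj (\<integral>x. kern y x * h x * ?e x \<partial>lborel)"
      by (simp only: integral_mult_right_zero Bochner_Integration.integral_cnj)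
    also have "\<dots> = of_real mass * (?e y * (v y * cnj (h y)))"
      by (simp only: reproducing_kern[OF h]) (simp add: mult_ac)
    finally show "(\<integral>x. ?F x y \<partial>lborel) = of_real mass * (?e y * (v y * cnj (h y)))" .
  qed
  also have "\<dots> / of_real mass = winner \<Phi> v h"
    unfolding winner_eq[OF \<open>v \<in> borel_measurable borel\<close> \<open>h \<in> borel_measurable borel\<close>]
    using mass_pos by simp
  finally have "winner \<Phi> (proj v) h = winner \<Phi> v h" .
  moreover have "winner \<Phi> (\<lambda>x. v x - proj v x) h = winner \<Phi> v h - winner \<Phi> (proj v) h"
    by (rule winner_diff[OF v w h2])
  ultimately show ?thesis by simp
qed

text \<open>Elements are functions and not classes, so zero norm gives vanishing almost everywhere
  only. The reproducing formula sees just the class and returns every point value; the uniqueness in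
  \<open>bargmann_proj\<close> depends on this.\<close>

lemma bargmann_zero:
  assumes d: "d \<in> bargmann_space \<Phi>" and 0: "winner \<Phi> d d = 0"
  shows "d x = 0"
proof -
  from d have d2: "d \<in> wL2 \<Phi>" by (simp add: bargmann_space_def)
  then have dm [measurable]: "d \<in> borel_measurable borel" and i: "integrable lborel (\<lambda>x. (red d x)\<^sup>2)"
    by (auto simp: wL2_iff)
  have "winner \<Phi> d d = (\<integral>x. of_real ((red d x)\<^sup>2) \<partial>lborel)"
    unfolding winner_eq[OF dm dm] red_sq complex_norm_square[symmetric] of_real_mult ..
  then have "(\<integral>x. (red d x)\<^sup>2 \<partial>lborel) = 0" using 0 by (simp del: of_real_power)
  then have "AE x in lborel. d x = 0"
    by (subst (asm) integral_nonneg_eq_0_iff_AE[OF i]) (auto simp: red_def)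
  then have "(\<integral>y. kern x y * d y * of_real (exp (- 2 * \<Phi> y)) \<partial>lborel) = 0"
    by (intro integral_eq_zero_AE) auto
  then show ?thesis using reproducing_kern[OF d, of x] mass_pos by simp
qed

text \<open>The difference of two candidates is itself a test function, hence orthogonal to
  itself.\<close>

lemma bargmann_proj_eq:
  assumes v: "v \<in> wL2 \<Phi>"
  shows "bargmann_proj \<Phi> v = proj v"
  unfolding bargmann_proj_def
proof (rule the_equality)
  show "proj v \<in> bargmann_space \<Phi> \<and> (\<forall>h\<in>bargmann_space \<Phi>. winner \<Phi> (\<lambda>x. v x - proj v x) h = 0)"
    using proj_bargmann[OF v] proj_orthogonal[OF v] by simp
next
  fix w assume w: "w \<in> bargmann_space \<Phi> \<and> (\<forall>h\<in>bargmann_space \<Phi>. winner \<Phi> (\<lambda>x. v x - w x) h = 0)"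
  define d where "d = (\<lambda>x. proj v x - w x)"
  have w2: "w \<in> wL2 \<Phi>" "proj v \<in> wL2 \<Phi>" using w proj_bargmann[OF v] by (simp_all add: bargmann_space_def)
  have d: "d \<in> bargmann_space \<Phi>"
    using w proj_bargmann[OF v] unfolding d_def bargmann_space_def
    by (auto intro: cn_holomorphic_diff wL2_diff)
  then have d2: "d \<in> wL2 \<Phi>" by (simp add: bargmann_space_def)
  from v w2 d2 have m: "v \<in> borel_measurable borel" "proj v \<in> borel_measurable borel"
      "w \<in> borel_measurable borel" "d \<in> borel_measurable borel"
    by (auto simp: wL2_iff)
  note [measurable] = m
  have "winner \<Phi> (\<lambda>x. (v x - w x) - (v x - proj v x)) d
      = winner \<Phi> (\<lambda>x. v x - w x) d - winner \<Phi> (\<lambda>x. v x - proj v x) d"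
    by (rule winner_diff[OF wL2_diff[OF v w2(1)] wL2_diff[OF v w2(2)] d2])
  also have "\<dots> = 0" using w d proj_orthogonal[OF v d] by simp
  finally have "winner \<Phi> d d = 0" by (simp add: d_def)
  from bargmann_zero[OF d this] show "w = proj v" by (simp add: d_def fun_eq_iff)
qed

end

section \<open>Gaussian kernels\<close>

lemma norm_sq_le_twice: "(norm (y::'a::real_inner))\<^sup>2 \<le> 2 * (norm x)\<^sup>2 + 2 * (norm (x - y))\<^sup>2"
proof -
  have "norm y \<le> norm x + norm (x - y)"
    by (metis norm_minus_commute norm_triangle_sub)
  then have "(norm y)\<^sup>2 \<le> (norm x + norm (x - y))\<^sup>2" by (intro power_mono) auto
  also have "\<dots> \<le> 2 * (norm x)\<^sup>2 + 2 * (norm (x - y))\<^sup>2"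
    using sum_squares_bound[of "norm x" "norm (x - y)"] by (simp add: power2_sum)
  finally show ?thesis .
qed

text \<open>The hypothesis \<open>split\<close> says that \<open>g\<close> is, up to a constant, the modulus of a Gaussian: it forces
  the same concavity of \<open>ln g\<close> everywhere. Hence decay of \<open>g\<close> on a single slice propagates to all
  slices, with centre at a near-maximum of the slice.\<close>

lemma quasi_gaussian_uniform_integral:
  fixes g :: "'a::real_vector \<Rightarrow> 'b::euclidean_space \<Rightarrow> real"
  assumes nonneg: "\<And>x y. 0 \<le> g x y" and bdd: "\<And>x y. g x y \<le> B"
    and split: "\<And>x1 y1 x2 y2. g x1 y1 * g x2 y2 = E (x1 + x2) (y1 + y2) * E' (x1 - x2) (y1 - y2)"
    and d: "d > 0" and decay: "\<And>x. \<exists>C. \<forall>y. g x y \<le> C * exp (- d * (norm y)\<^sup>2)"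
  shows "\<exists>A\<ge>0. \<forall>x. (\<integral>\<^sup>+y. ennreal (g x y) \<partial>lborel) \<le> ennreal A"
proof (cases "\<forall>x y. g x y = 0")
  case True
  then show ?thesis by (intro exI[of _ 0]) simp
next
  case False
  then obtain x0 y0 where "g x0 y0 \<noteq> 0" by blast
  then have g0: "g x0 y0 > 0" using nonneg[of x0 y0] by linarith
  have B: "B \<ge> 0" using nonneg bdd order_trans by blast
  obtain C0 where C0: "\<And>y. g x0 y \<le> C0 * exp (- d * (norm y)\<^sup>2)" using decay[of x0] by blast
  have C0_nn: "C0 \<ge> 0" using nonneg[of x0 0] C0[of 0] by simp
  define C1 where "C1 = C0\<^sup>2 / (g x0 y0)\<^sup>2"
  have C1_nn: "C1 \<ge> 0" by (simp add: C1_def)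
  \<comment> \<open>By \<open>split\<close>, the dependence on \<open>k\<close> sits in
    \<open>E' 0 (k + k)\<close> whatever the centre. Cross-multiplying with the values at
    \<open>(x0, y0)\<close> therefore carries the known decay of the slice at \<open>x0\<close> to
    every slice, with a constant independent of \<open>x\<close>.\<close>
  have mid: "g x (y + k) * g x (y - k) \<le> C1 * exp (- 2 * d * (norm k)\<^sup>2) * (g x y)\<^sup>2" for x y k
  proof -
    have "g x (y + k) * g x (y - k) * (g x0 y0 * g x0 y0)
        = (g x y * g x y) * (g x0 (y0 + k) * g x0 (y0 - k))"
      unfolding split by (simp add: algebra_simps)
    also have "\<dots> \<le> (g x y * g x y) * (C0 * exp (- d * (norm (y0 + k))\<^sup>2) * (C0 * exp (- d * (norm (y0 - k))\<^sup>2)))"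
      by (intro mult_left_mono mult_mono C0) (use nonneg C0_nn in auto)
    also have "\<dots> = (g x y * g x y) * (C0\<^sup>2 * exp (- d * ((norm (y0 + k))\<^sup>2 + (norm (y0 - k))\<^sup>2)))"
      by (simp add: power2_eq_square exp_add[symmetric] algebra_simps)
    also have "\<dots> \<le> (g x y * g x y) * (C0\<^sup>2 * exp (- 2 * d * (norm k)\<^sup>2))"
    proof -
      have "(norm (y0 + k))\<^sup>2 + (norm (y0 - k))\<^sup>2 = 2 * (norm y0)\<^sup>2 + 2 * (norm k)\<^sup>2"
        unfolding power2_norm_eq_inner by (simp add: inner_add inner_diff inner_commute)
      then have "- d * ((norm (y0 + k))\<^sup>2 + (norm (y0 - k))\<^sup>2) \<le> - 2 * d * (norm k)\<^sup>2"
        using d by (simp add: algebra_simps)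
      then show ?thesis using nonneg by (intro mult_left_mono) auto
    qed
    finally show ?thesis
      using g0 by (simp add: C1_def field_simps power2_eq_square)
  qed
  define J where "J = (\<integral>(y::'b). exp (- (d / 2) * (norm y)\<^sup>2) \<partial>lborel)"
  have J: "(\<integral>\<^sup>+y. ennreal (exp (- (d / 2) * (norm (y - c))\<^sup>2)) \<partial>lborel) = ennreal J" for c :: 'b
  proof -
    have "(\<integral>\<^sup>+(y::'b). ennreal (exp (- (d / 2) * (norm y)\<^sup>2)) \<partial>lborel) = ennreal J"
      unfolding J_def by (rule nn_integral_eq_integral[OF integrable_gauss]) (use d in auto)
    then show ?thesis
      using nn_integral_lborel_diff[of "\<lambda>y. ennreal (exp (- (d / 2) * (norm y)\<^sup>2))" c] by simp
  qed
  have J_nn: "J \<ge> 0" by (simp add: J_def)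
  have "(\<integral>\<^sup>+y. ennreal (g x y) \<partial>lborel) \<le> ennreal (2 * C1 * B * J)" for x
  proof (cases "\<forall>y. g x y = 0")
    case True
    then show ?thesis by simp
  next
    case False
    define S where "S = (SUP y. g x y)"
    have bdd_S: "bdd_above (range (g x))" by (rule bdd_aboveI[of _ B]) (use bdd in auto)
    have S_ge: "g x y \<le> S" for y unfolding S_def by (rule cSUP_upper[OF _ bdd_S]) simp
    from False obtain y where "g x y \<noteq> 0" by blast
    then have "S > 0" using S_ge[of y] nonneg[of x y] by linarith
    then have "S / 2 < S" by simp
    \<comment> \<open>The supremum need not be attained; a point within a factor 2 of it is enough
      to bound every value of the slice by \<open>2 * g x c\<close>.\<close>
    then obtain c where c: "S / 2 < g x c"
      using less_cSUP_iff[OF UNIV_not_empty bdd_S, of "S / 2", folded S_def] by blast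
    have gc: "g x c > 0" using c \<open>S > 0\<close> by linarith
    have "g x y \<le> 2 * C1 * B * exp (- (d / 2) * (norm (y - c))\<^sup>2)" for y
    proof -
      \<comment> \<open>The midpoint inequality is used at \<open>c + k\<close>, between
        \<open>c\<close> and \<open>y\<close>. One of the two factors \<open>g x (c + k)\<close> is
        bounded by \<open>B\<close>, the other by \<open>2 * g x c\<close>, which then cancels. As
        \<open>k\<close> is half of \<open>y - c\<close>, the rate \<open>2 * d\<close> becomes
        \<open>d / 2\<close>.\<close>
      define k where "k = (1 / 2) *\<^sub>R (y - c)"
      have "k + k = y - c" by (simp only: k_def scaleR_add_right[symmetric] scaleR_half_double)
      then have k: "c + k + k = y" by (simp add: add.assoc)
      have nk: "(norm k)\<^sup>2 = (norm (y - c))\<^sup>2 / 4" by (simp add: k_def power_mult_distrib power_divide)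
      have "g x y * g x c \<le> C1 * exp (- 2 * d * (norm k)\<^sup>2) * (g x (c + k) * g x (c + k))"
        using mid[of x "c + k" k] by (simp add: k power2_eq_square)
      also have "\<dots> \<le> C1 * exp (- 2 * d * (norm k)\<^sup>2) * (B * (2 * g x c))"
        by (intro mult_left_mono mult_mono bdd) (use nonneg C1_nn B S_ge[of "c + k"] c in auto)
      also have "\<dots> = 2 * C1 * B * exp (- (d / 2) * (norm (y - c))\<^sup>2) * g x c"
        by (simp add: nk)
      finally show ?thesis using gc by simp
    qed
    then have "(\<integral>\<^sup>+y. ennreal (g x y) \<partial>lborel)
        \<le> (\<integral>\<^sup>+y. ennreal (2 * C1 * B) * ennreal (exp (- (d / 2) * (norm (y - c))\<^sup>2)) \<partial>lborel)"
      using C1_nn B by (intro nn_integral_mono) (simp add: ennreal_mult[symmetric] ennreal_leI)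
    also have "\<dots> = ennreal (2 * C1 * B) * ennreal J"
      unfolding J[of c, symmetric] by (rule nn_integral_cmult) simp
    finally show ?thesis using C1_nn B J_nn by (simp add: ennreal_mult)
  qed
  then show ?thesis using C1_nn B J_nn by (intro exI[of _ "2 * C1 * B * J"]) simp
qed

text \<open>The substitution by half-sum and difference has unit Jacobian and is carried out as two
  translations around a Fubini exchange. Hypothesis \<open>UV\<close> uses the displacement
  \<open>r\<close> on both sides, so the difference variable enters \<open>V\<close> halved.\<close>

lemma integral_product_split:
  fixes f1 f2 U V :: "'a::euclidean_space \<Rightarrow> complex"
  assumes i1: "integrable lborel f1" and i2: "integrable lborel f2"
    and UV: "\<And>w r. f1 (w + r) * f2 (w - r) = U w * V r"
  shows "(\<integral>y. f1 y \<partial>lborel) * (\<integral>y. f2 y \<partial>lborel)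
    = (\<integral>w. U w \<partial>lborel) * (\<integral>r. V ((1 / 2) *\<^sub>R r) \<partial>lborel)"
proof -
  have [measurable]: "f1 \<in> borel_measurable borel" "f2 \<in> borel_measurable borel"
    using i1 i2 by auto
  have i: "integrable (lborel \<Otimes>\<^sub>M lborel) (\<lambda>(y, r). f1 (y + r) * f2 y)"
  proof (rule lborel_pair.Fubini_integrable)
    show "(\<lambda>(y, r). f1 (y + r) * f2 y) \<in> borel_measurable (lborel \<Otimes>\<^sub>M lborel)" by measurable
    have "(\<integral>r. norm (f1 (y + r) * f2 y) \<partial>lborel) = (\<integral>r. norm (f1 r) \<partial>lborel) * norm (f2 y)" for y
      using lborel_integral_translate[of "\<lambda>r. norm (f1 r)" y] by (simp add: norm_mult)
    then show "integrable lborel (\<lambda>y. \<integral>r. norm (case (y, r) of (y, r) \<Rightarrow> f1 (y + r) * f2 y) \<partial>lborel)"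
      using i2 by simp
    show "AE y in lborel. integrable lborel (\<lambda>r. case (y, r) of (y, r) \<Rightarrow> f1 (y + r) * f2 y)"
      using i1 lborel_integrable_translate_iff[of f1] by simp
  qed
  have "(\<integral>y. f1 y \<partial>lborel) * (\<integral>y. f2 y \<partial>lborel) = (\<integral>y. (\<integral>r. f1 (y + r) * f2 y \<partial>lborel) \<partial>lborel)"
    using lborel_integral_translate[of f1] by simp
  also have "\<dots> = (\<integral>r. (\<integral>y. f1 (y + r) * f2 y \<partial>lborel) \<partial>lborel)"
    by (rule lborel_pair.Fubini_integral[OF i, symmetric])
  also have "\<dots> = (\<integral>r. (\<integral>w. U w * V ((1 / 2) *\<^sub>R r) \<partial>lborel) \<partial>lborel)"
  proof (rule Bochner_Integration.integral_cong[OF refl])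
    fix r :: 'a
    have "(\<integral>y. f1 (y + r) * f2 y \<partial>lborel)
      = (\<integral>y. f1 ((- ((1 / 2) *\<^sub>R r) + y) + r) * f2 (- ((1 / 2) *\<^sub>R r) + y) \<partial>lborel)"
      by (rule lborel_integral_translate[symmetric]) measurable
    also have "\<dots> = (\<integral>w. U w * V ((1 / 2) *\<^sub>R r) \<partial>lborel)"
    proof (rule Bochner_Integration.integral_cong[OF refl])
      fix w
      have e: "(w - (1 / 2) *\<^sub>R r) + r = w + (1 / 2) *\<^sub>R r" "- ((1 / 2) *\<^sub>R r) + w = w - (1 / 2) *\<^sub>R r"
        using scaleR_half_double[of r] by (simp_all add: scaleR_add_right algebra_simps)
      show "f1 ((- ((1 / 2) *\<^sub>R r) + w) + r) * f2 (- ((1 / 2) *\<^sub>R r) + w) = U w * V ((1 / 2) *\<^sub>R r)"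
        unfolding e by (rule UV)
    qed
    finally show "(\<integral>y. f1 (y + r) * f2 y \<partial>lborel) = (\<integral>w. U w * V ((1 / 2) *\<^sub>R r) \<partial>lborel)" .
  qed
  \<comment> \<open>A constant factor leaves the integral even in the divergent case, where both
    sides take the default value 0; so \<open>U\<close> and \<open>V\<close> need no integrability
    of their own.\<close>
  also have "\<dots> = (\<integral>w. U w \<partial>lborel) * (\<integral>r. V ((1 / 2) *\<^sub>R r) \<partial>lborel)" by simp
  finally show ?thesis .
qed

section \<open>Decay and product structure of the Toeplitz kernel\<close>

locale toeplitz_gaussian = bargmann_weight H m f \<Phi>
  for H :: "complex ^ 'n \<Rightarrow> complex ^ 'n \<Rightarrow> complex" and m :: real
    and f :: "complex ^ 'n \<Rightarrow> complex" and \<Phi> :: "complex ^ 'n \<Rightarrow> real" +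
  fixes Q q L :: "complex ^ 'n \<Rightarrow> complex" and c :: complex and \<epsilon> C0 :: real
  assumes Q_eq: "\<And>x. Q x = q x + L x + c" and L: "linear L"
    and q_parallelogram: "\<And>x y. q (x + y) + q (x - y) = 2 * q x + 2 * q y"
    and measurable_Q [measurable]: "Q \<in> borel_measurable borel"
    and eps: "\<epsilon> > 0" and Q_le: "\<And>y. Re (Q y) \<le> N y - \<epsilon> * (norm y)\<^sup>2 + C0"
begin

definition G_integrand where
  "G_integrand x s y = exp (2 * H x y + 2 * H y s - of_real (2 * N y) + Q y)"

definition G where "G x s = (\<integral>y. G_integrand x s y \<partial>lborel)"

definition g where "g x s = cmod (G x s) * exp (- N x - N s)"

lemma g_nonneg: "0 \<le> g x s" by (simp add: g_def)

lemma measurable_G_integrand [measurable (raw)]: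
  assumes [measurable]: "a \<in> borel_measurable M" "b \<in> borel_measurable M" "e \<in> borel_measurable M"
  shows "(\<lambda>x. G_integrand (a x) (b x) (e x)) \<in> borel_measurable M"
  unfolding G_integrand_def by measurable

lemma measurable_G: "case_prod G \<in> borel_measurable (borel \<Otimes>\<^sub>M borel)"
  unfolding G_def by measurable

lemma measurable_g: "case_prod g \<in> borel_measurable (borel \<Otimes>\<^sub>M borel)"
  using measurable_G unfolding g_def by measurable

lemma cmod_G_integrand:
  "cmod (G_integrand x s y) = exp (N x + N s) * exp (Re (Q y) - N (x - y) - N (y - s))"
  by (simp add: G_integrand_def N_diff exp_add[symmetric])

lemma G_integrand_decay:
  obtains K where "K > 0"
   "\<And>x s y. exp (Re (Q y) - N (x - y) - N (y - s))
      \<le> exp (C0 + K * (norm x)\<^sup>2) * exp (- (\<epsilon> / 2) * (norm y)\<^sup>2 - m * (norm (y - s))\<^sup>2)"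
   "\<And>x s y. exp (Re (Q y) - N (x - y) - N (y - s))
      \<le> exp (C0 + K * (norm s)\<^sup>2) * exp (- (\<epsilon> / 2) * (norm y)\<^sup>2 - m * (norm (y - x))\<^sup>2)"
proof -
  obtain K where K: "K > 0" "\<And>x y. cmod (H x y) \<le> K * norm x * norm y" by (rule H_bound) blast
  have *: "Re (Q y) - N (x - y) \<le> C0 + (2 * K\<^sup>2 / \<epsilon>) * (norm x)\<^sup>2 - (\<epsilon> / 2) * (norm y)\<^sup>2" for x y
  proof -
    have "Re (H x y) \<le> K * norm x * norm y" using K(2)[of x y] complex_Re_le_cmod[of "H x y"] by linarith
    \<comment> \<open>Young's inequality weighted so that the cross term consumes exactly half of
      the margin \<open>\<epsilon>\<close>.\<close>
    moreover have "0 \<le> (\<epsilon> * norm y - 2 * K * norm x)\<^sup>2 / (2 * \<epsilon>)" using eps by simp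
    then have "2 * (K * norm x * norm y) \<le> (2 * K\<^sup>2 / \<epsilon>) * (norm x)\<^sup>2 + (\<epsilon> / 2) * (norm y)\<^sup>2"
      using eps by (simp add: power2_eq_square field_simps)
    ultimately show ?thesis using Q_le[of y] N_nonneg[of x] unfolding N_diff by linarith
  qed
  have Ns: "N (x - y) = N (y - x)" for x y using N_minus[of "x - y"] by simp
  show ?thesis
  proof (rule that[of "2 * K\<^sup>2 / \<epsilon>"])
    show "2 * K\<^sup>2 / \<epsilon> > 0" using K eps by simp
  next
    fix x s y
    show "exp (Re (Q y) - N (x - y) - N (y - s))
      \<le> exp (C0 + (2 * K\<^sup>2 / \<epsilon>) * (norm x)\<^sup>2) * exp (- (\<epsilon> / 2) * (norm y)\<^sup>2 - m * (norm (y - s))\<^sup>2)"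
      using *[of y x] N_ge[of "y - s"] unfolding exp_add[symmetric] by simp
    show "exp (Re (Q y) - N (x - y) - N (y - s))
      \<le> exp (C0 + (2 * K\<^sup>2 / \<epsilon>) * (norm s)\<^sup>2) * exp (- (\<epsilon> / 2) * (norm y)\<^sup>2 - m * (norm (y - x))\<^sup>2)"
      using *[of y s] N_ge[of "y - x"] Ns[of y s] Ns[of x y] unfolding exp_add[symmetric] by simp
  qed
qed

lemma integrable_G_integrand: "integrable lborel (G_integrand x s)"
proof -
  obtain K where K: "\<And>x s y. exp (Re (Q y) - N (x - y) - N (y - s))
      \<le> exp (C0 + K * (norm x)\<^sup>2) * exp (- (\<epsilon> / 2) * (norm y)\<^sup>2 - m * (norm (y - s))\<^sup>2)"
    by (rule G_integrand_decay) blast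
  show ?thesis
  proof (rule integrable_gauss_dominated)
    show "\<epsilon> / 2 > 0" using eps by simp
    fix y
    have "exp (Re (Q y) - N (x - y) - N (y - s)) \<le> exp (C0 + K * (norm x)\<^sup>2) * exp (- (\<epsilon> / 2) * (norm y)\<^sup>2)"
      using K[of y x s] by (rule order_trans) (use m_pos in simp)
    then show "norm (G_integrand x s y) \<le> (exp (N x + N s) * exp (C0 + K * (norm x)\<^sup>2)) * exp (- (\<epsilon> / 2) * (norm y)\<^sup>2)"
      unfolding cmod_G_integrand mult.assoc by (rule mult_left_mono) simp
  qed simp
qed

text \<open>A large \<open>s\<close> forces \<open>y\<close> or \<open>y - s\<close> to be large.
  Half of the decay in \<open>y\<close> pays for this, and the other half keeps the integral over
  \<open>y\<close> finite; the division by 2 in the rate comes from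
  \<open>norm_sq_le_twice\<close>.\<close>

lemma gaussian_peak_decay:
  "exp (- (\<epsilon> / 2) * (norm y)\<^sup>2 - m * (norm (y - s))\<^sup>2)
    \<le> exp (- (min (\<epsilon> / 4) m / 2) * (norm s)\<^sup>2) * exp (- (\<epsilon> / 4) * (norm (y :: complex ^ 'n))\<^sup>2)"
proof -
  let ?d = "min (\<epsilon> / 4) m"
  have "?d / 2 * (norm s)\<^sup>2 \<le> ?d / 2 * (2 * (norm y)\<^sup>2 + 2 * (norm (y - s))\<^sup>2)"
    using eps m_pos by (intro mult_left_mono norm_sq_le_twice) auto
  also have "\<dots> = ?d * (norm y)\<^sup>2 + ?d * (norm (y - s))\<^sup>2" by (simp add: algebra_simps)
  also have "\<dots> \<le> \<epsilon> / 4 * (norm y)\<^sup>2 + m * (norm (y - s))\<^sup>2"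
    by (intro add_mono mult_right_mono) auto
  finally show ?thesis unfolding exp_add[symmetric] by simp
qed

lemma g_le_integral:
  "g x s \<le> (\<integral>y. exp (Re (Q y) - N (x - y) - N (y - s)) \<partial>lborel)"
proof -
  have "cmod (G x s) \<le> (\<integral>y. cmod (G_integrand x s y) \<partial>lborel)"
    unfolding G_def by (rule integral_norm_bound)
  then have "g x s \<le> (\<integral>y. cmod (G_integrand x s y) \<partial>lborel) * exp (- N x - N s)"
    unfolding g_def by (rule mult_right_mono) simp
  also have "\<dots> = (\<integral>y. exp (Re (Q y) - N (x - y) - N (y - s)) \<partial>lborel)"
    unfolding cmod_G_integrand integral_mult_right_zero
    by (simp add: mult.commute mult.left_commute exp_add[symmetric])
  finally show ?thesis .
qed

lemma g_decay:
  "\<exists>C. \<forall>s. g x s \<le> C * exp (- (min (\<epsilon> / 4) m / 2) * (norm s)\<^sup>2)"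
  "\<exists>C. \<forall>x. g x s \<le> C * exp (- (min (\<epsilon> / 4) m / 2) * (norm x)\<^sup>2)"
proof -
  obtain K where K: "\<And>x s y. exp (Re (Q y) - N (x - y) - N (y - s))
      \<le> exp (C0 + K * (norm x)\<^sup>2) * exp (- (\<epsilon> / 2) * (norm y)\<^sup>2 - m * (norm (y - s))\<^sup>2)"
    "\<And>x s y. exp (Re (Q y) - N (x - y) - N (y - s))
      \<le> exp (C0 + K * (norm s)\<^sup>2) * exp (- (\<epsilon> / 2) * (norm y)\<^sup>2 - m * (norm (y - x))\<^sup>2)"
    by (rule G_integrand_decay) blast
  define J where "J = (\<integral>y. exp (- (\<epsilon> / 4) * (norm (y :: complex ^ 'n))\<^sup>2) \<partial>lborel)"
  have *: "g x s \<le> (c * J) * exp (- (min (\<epsilon> / 4) m / 2) * (norm t)\<^sup>2)"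
    if c: "c \<ge> 0" and le: "\<And>y. exp (Re (Q y) - N (x - y) - N (y - s))
        \<le> c * exp (- (\<epsilon> / 2) * (norm y)\<^sup>2 - m * (norm (y - t))\<^sup>2)" for x s t c
  proof -
    let ?e = "exp (- (min (\<epsilon> / 4) m / 2) * (norm t)\<^sup>2)"
    have i: "integrable lborel (\<lambda>y :: complex ^ 'n. (c * ?e) * exp (- (\<epsilon> / 4) * (norm y)\<^sup>2))"
      by (intro integrable_mult_right integrable_gauss) (use eps in simp)
    have le': "exp (Re (Q y) - N (x - y) - N (y - s)) \<le> (c * ?e) * exp (- (\<epsilon> / 4) * (norm y)\<^sup>2)" for y
      using order_trans[OF le mult_left_mono[OF gaussian_peak_decay c]] by (simp add: mult.assoc)
    have "integrable lborel (\<lambda>y. exp (Re (Q y) - N (x - y) - N (y - s)))"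
    proof (rule Bochner_Integration.integrable_bound[OF i])
      show "AE y in lborel. norm (exp (Re (Q y) - N (x - y) - N (y - s))) \<le> norm ((c * ?e) * exp (- (\<epsilon> / 4) * (norm y)\<^sup>2))"
        using le' c by (intro AE_I2) (simp add: abs_mult)
    qed simp
    then have "(\<integral>y. exp (Re (Q y) - N (x - y) - N (y - s)) \<partial>lborel) \<le> (\<integral>y. (c * ?e) * exp (- (\<epsilon> / 4) * (norm (y :: complex ^ 'n))\<^sup>2) \<partial>lborel)"
      by (rule integral_mono[OF _ i le'])
    also have "\<dots> = (c * J) * ?e" unfolding J_def by simp
    finally show ?thesis using g_le_integral[of x s] by linarith
  qed
  show "\<exists>C. \<forall>s. g x s \<le> C * exp (- (min (\<epsilon> / 4) m / 2) * (norm s)\<^sup>2)"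
    by (rule exI, rule allI, rule *[OF _ K(1)]) simp
  show "\<exists>C. \<forall>x. g x s \<le> C * exp (- (min (\<epsilon> / 4) m / 2) * (norm x)\<^sup>2)"
    by (rule exI, rule allI, rule *[OF _ K(2)]) simp
qed

text \<open>The exponent of the integrand consists of terms linear in \<open>y\<close>, a constant,
  and \<open>- p y\<close>. Under \<open>w + r\<close> and \<open>w - r\<close> the parallelogram
  law for \<open>p\<close> removes the cross terms, which leaves \<open>U\<close> in the sums and
  \<open>V\<close> in the differences.\<close>

lemma g_split:
  obtains E E' where "\<And>x1 s1 x2 s2. g x1 s1 * g x2 s2 = E (x1 + x2) (s1 + s2) * E' (x1 - x2) (s1 - s2)"
proof -
  define p where "p y = of_real (2 * N y) - q y" for y
  define U where "U x s w = exp (2 * H x w + 2 * H w s + 2 * L w + 2 * c - 2 * p w)" for x s w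
  define V where "V x s r = exp (2 * H x r + 2 * H r s - 2 * p r)" for x s r
  have p: "p (w + r) + p (w - r) = 2 * p w + 2 * p r" for w r
  proof -
    have "p (w + r) + p (w - r) = of_real (2 * N (w + r) + 2 * N (w - r)) - (q (w + r) + q (w - r))"
      by (simp add: p_def)
    then show ?thesis unfolding q_parallelogram N_add N_diff by (simp add: p_def algebra_simps)
  qed
  have UV: "G_integrand x1 s1 (w + r) * G_integrand x2 s2 (w - r)
      = U (x1 + x2) (s1 + s2) w * V (x1 - x2) (s1 - s2) r" for x1 s1 x2 s2 w r
  proof -
    have e: "2 * H x y + 2 * H y s - of_real (2 * N y) + Q y = 2 * H x y + 2 * H y s + L y + c - p y" for x s y
      by (simp add: p_def Q_eq)
    have "(2 * H x1 (w + r) + 2 * H (w + r) s1 + L (w + r) + c - p (w + r))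
      + (2 * H x2 (w - r) + 2 * H (w - r) s2 + L (w - r) + c - p (w - r))
      = (2 * H (x1 + x2) w + 2 * H w (s1 + s2) + 2 * L w + 2 * c - 2 * p w)
        + (2 * H (x1 - x2) r + 2 * H r (s1 - s2) - 2 * p r)"
      using p[of w r] by (simp add: add_left add_right diff_left diff_right linear_add[OF L] linear_diff[OF L] algebra_simps)
    then show ?thesis
      unfolding G_integrand_def U_def V_def e exp_add[symmetric] by (rule arg_cong)
  qed
  \<comment> \<open>The exponents are halved because the parallelogram law, read backwards, gives
    \<open>N x1 + N x2 = (N (x1 + x2) + N (x1 - x2)) / 2\<close>.\<close>
  define E where "E x s = cmod (\<integral>w. U x s w \<partial>lborel) * exp (- (N x + N s) / 2)" for x s
  define E' where "E' x s = cmod (\<integral>r. V x s ((1 / 2) *\<^sub>R r) \<partial>lborel) * exp (- (N x + N s) / 2)" for x s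
  show ?thesis
  proof (rule that[of E E'])
    fix x1 s1 x2 s2
    have "G x1 s1 * G x2 s2 = (\<integral>w. U (x1 + x2) (s1 + s2) w \<partial>lborel) * (\<integral>r. V (x1 - x2) (s1 - s2) ((1 / 2) *\<^sub>R r) \<partial>lborel)"
      unfolding G_def by (rule integral_product_split[OF integrable_G_integrand integrable_G_integrand UV])
    then have "cmod (G x1 s1) * cmod (G x2 s2) = cmod (\<integral>w. U (x1 + x2) (s1 + s2) w \<partial>lborel)
        * cmod (\<integral>r. V (x1 - x2) (s1 - s2) ((1 / 2) *\<^sub>R r) \<partial>lborel)"
      by (metis norm_mult)
    moreover have "exp (- N x1 - N s1) * exp (- N x2 - N s2)
      = exp (- (N (x1 + x2) + N (s1 + s2)) / 2) * exp (- (N (x1 - x2) + N (s1 - s2)) / 2)"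
      unfolding exp_add[symmetric] N_add N_diff by (simp add: field_simps)
    ultimately show "g x1 s1 * g x2 s2 = E (x1 + x2) (s1 + s2) * E' (x1 - x2) (s1 - s2)"
      unfolding g_def E_def E'_def by (simp add: mult_ac)
  qed
qed

end

section \<open>The Weyl symbol and boundedness\<close>

context hermitian_form
begin

text \<open>The Gaussian in the symbol and the one it is tested against contribute
  \<open>4 * N z\<close> each. The sum \<open>8 * N z\<close> is the weight of the reproducing
  formula for \<open>4 * H\<close>.\<close>

lemma hermitian_form_scaled: "hermitian_form (\<lambda>x y. 4 * H x y) (4 * m)"
proof
  show "4 * H (x + y) z = 4 * H x z + 4 * H y z" for x y z by (simp add: add_left)
  show "4 * H (cscale c x) y = c * (4 * H x y)" for c x y by (simp add: cscale_left)
  show "4 * H y x = cnj (4 * H x y)" for x y by (simp add: hermitian[of x y])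
  show "4 * m > 0" using m_pos by simp
  show "4 * m * (norm x)\<^sup>2 \<le> Re (4 * H x x)" for x using coercive[of x] by simp
qed

end

context toeplitz_gaussian
begin

definition symb where "symb z = (\<integral>y. of_real (exp (- 4 * N (z - y))) * exp (Q y) \<partial>lborel)"

text \<open>Completing the square in \<open>z\<close>: the two Gaussians centred at \<open>y\<close>
  and at \<open>(x + s) / 2\<close> merge into one at their mean, with doubled rate. The remaining
  dependence on \<open>y\<close> is the modulus of \<open>G_integrand\<close>, whose integrability
  then justifies Fubini.\<close>

lemma symb_integrand_norm:
  "cmod (exp (4 * H x z + 4 * H z s - of_real (4 * N z)) * (of_real (exp (- 4 * N (z - y))) * exp (Q y)))
    = exp (N (x + s) / 2) * cmod (G_integrand x s y) * exp (- 8 * N (z - (1 / 2) *\<^sub>R (y + (1 / 2) *\<^sub>R (x + s))))"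
proof -
  have h: "Re (H b a) = Re (H a b)" for a b using hermitian[of a b] by simp
  have n: "N (z - (1 / 2) *\<^sub>R (y + (1 / 2) *\<^sub>R (x + s)))
      = N z + (N y + N (x + s) / 4 + Re (H y x) + Re (H y s)) / 4 - Re (H z y) - Re (H z x) / 2 - Re (H z s) / 2"
    unfolding N_diff[of z] N_scaleR N_add[of y] by (simp add: scaleR_right add_right power2_eq_square field_simps)
  show ?thesis
    unfolding G_integrand_def norm_mult norm_exp_eq_Re norm_of_real abs_exp_cancel exp_add[symmetric]
    by (rule arg_cong[where f = exp])
       (simp only: n N_diff[of z y], simp add: h[of x y] h[of x z] field_simps)
qed

text \<open>When the \<open>z\<close> integral is done before the \<open>y\<close> integral of the
  symbol, it is a reproducing integral for \<open>4 * H\<close>, and its value is the integrand of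
  \<open>G\<close> up to \<open>exp (2 * H x s)\<close>. It matters that \<open>M\<close> does not
  depend on \<open>x\<close> and \<open>s\<close>.\<close>

lemma G_eq_symb:
  shows "\<exists>M>0. \<forall>x s. integrable lborel (\<lambda>z. exp (4 * H x z + 4 * H z s - of_real (4 * N z)) * symb z) \<and>
      of_real M * G x s = exp (- 2 * H x s) * (\<integral>z. exp (4 * H x z + 4 * H z s - of_real (4 * N z)) * symb z \<partial>lborel)"
proof -
  interpret H4: hermitian_form "\<lambda>x y. 4 * H x y" "4 * m" by (rule hermitian_form_scaled)
  have N4: "H4.N x = 4 * N x" for x by (simp add: H4.N_def N_def)
  have i8: "integrable lborel (\<lambda>z. exp (- 8 * N (z - b)))" for b
    using lborel_integrable_translate_iff[of "\<lambda>z. exp (- 8 * N z)" "-b"] integrable_exp_N[of 8] by simp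
  have s8: "(\<integral>z. exp (- 8 * N (z - b)) \<partial>lborel) = (\<integral>z. exp (- 8 * N z) \<partial>lborel)" for b
    using lborel_integral_translate[of "\<lambda>z. exp (- 8 * N z)" "-b"] by simp
  have "integrable lborel (\<lambda>z. exp (4 * H x z + 4 * H z s - of_real (4 * N z)) * symb z) \<and>
      of_real H4.mass * G x s = exp (- 2 * H x s) * (\<integral>z. exp (4 * H x z + 4 * H z s - of_real (4 * N z)) * symb z \<partial>lborel)" for x s
  proof -
    let ?e = "\<lambda>z. exp (4 * H x z + 4 * H z s - of_real (4 * N z))"
    let ?T = "\<lambda>y z. ?e z * (of_real (exp (- 4 * N (z - y))) * exp (Q y))"
    have Tm: "(\<lambda>(y, z). ?T y z) \<in> borel_measurable (lborel \<Otimes>\<^sub>M lborel)" by measurable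
    have Ti: "integrable lborel (\<lambda>z. ?T y z)" for y
    proof (rule Bochner_Integration.integrable_bound)
      show "integrable lborel (\<lambda>z. exp (N (x + s) / 2) * cmod (G_integrand x s y) * exp (- 8 * N (z - (1 / 2) *\<^sub>R (y + (1 / 2) *\<^sub>R (x + s)))))"
        by (intro integrable_mult_right i8)
      show "AE z in lborel. norm (?T y z) \<le> norm (exp (N (x + s) / 2) * cmod (G_integrand x s y) * exp (- 8 * N (z - (1 / 2) *\<^sub>R (y + (1 / 2) *\<^sub>R (x + s)))))"
        unfolding symb_integrand_norm by simp
      show "(\<lambda>z. ?T y z) \<in> borel_measurable lborel" by measurable
    qed
    have i: "integrable (lborel \<Otimes>\<^sub>M lborel) (\<lambda>(y, z). ?T y z)"
    proof (rule lborel_pair.Fubini_integrable[OF Tm])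
      show "AE y in lborel. integrable lborel (\<lambda>z. case (y, z) of (y, z) \<Rightarrow> ?T y z)"
        using Ti by simp
      show "integrable lborel (\<lambda>y. \<integral>z. norm (case (y, z) of (y, z) \<Rightarrow> ?T y z) \<partial>lborel)"
        unfolding prod.case symb_integrand_norm integral_mult_right_zero s8
        by (intro integrable_mult_left integrable_mult_right integrable_norm integrable_G_integrand)
    qed
    have inner: "(\<integral>z. ?T y z \<partial>lborel) = of_real H4.mass * exp (2 * H x s) * G_integrand x s y" for y
    proof -
      define \<phi> where "\<phi> = (\<lambda>z. exp (4 * H z (s + y)))"
      let ?a = "(1 / 2) *\<^sub>R (x + y)"
      have \<phi>: "cn_holomorphic \<phi>" unfolding \<phi>_def by (intro cn_holomorphic_exp cn_holomorphic_cmult_H)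
      \<comment> \<open>Terms conjugate-linear in \<open>z\<close> form the kernel with base point
        \<open>(x + y) / 2\<close>, terms linear in \<open>z\<close> form the entire function
        \<open>\<phi>\<close>, and the rest is constant.\<close>
      have eq: "?T y z = exp (Q y - of_real (4 * N y)) * (exp (2 * (4 * H ?a z) - of_real (2 * H4.N z)) * \<phi> z)" for z
      proof -
        have "of_real (- 4 * N (z - y)) = - of_real (4 * N z) - of_real (4 * N y) + (4 * H z y + 4 * H y z)"
          by (simp add: N_diff hermitian[of z y] complex_eq_iff)
        then have "4 * H x z + 4 * H z s - of_real (4 * N z) + (of_real (- 4 * N (z - y)) + Q y)
          = (Q y - of_real (4 * N y)) + ((2 * (4 * H ?a z) - of_real (2 * H4.N z)) + 4 * H z (s + y))"
          unfolding N4 by (simp add: scaleR_left add_left add_right algebra_simps)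
        then show ?thesis unfolding \<phi>_def exp_of_real[symmetric] exp_add[symmetric] by (rule arg_cong)
      qed
      have cancel: "exp (- a) * (exp a * b) = b" for a b :: complex by (simp add: exp_minus)
      have "integrable lborel (\<lambda>z. exp (2 * (4 * H ?a z) - of_real (2 * H4.N z)) * \<phi> z)"
        using integrable_mult_right[OF Ti[of y, unfolded eq], of "exp (- (Q y - of_real (4 * N y)))"]
        unfolding cancel .
      from H4.reproducing_formula[OF \<phi> this]
      have "(\<integral>z. ?T y z \<partial>lborel) = exp (Q y - of_real (4 * N y)) * (of_real H4.mass * \<phi> ?a)"
        unfolding eq by simp
      also have "\<dots> = of_real H4.mass * (exp (Q y - of_real (4 * N y)) * \<phi> ?a)" by simp
      also have "exp (Q y - of_real (4 * N y)) * \<phi> ?a = exp (2 * H x s) * G_integrand x s y"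
        unfolding \<phi>_def G_integrand_def exp_add[symmetric]
        by (rule arg_cong[where f = exp]) (simp add: scaleR_left add_left add_right H_diag algebra_simps)
      finally show ?thesis by simp
    qed
    have "(\<integral>z. (\<integral>y. ?T y z \<partial>lborel) \<partial>lborel) = (\<integral>y. (\<integral>z. ?T y z \<partial>lborel) \<partial>lborel)"
      by (rule lborel_pair.Fubini_integral[OF i])
    then have "(\<integral>z. ?e z * symb z \<partial>lborel) = of_real H4.mass * exp (2 * H x s) * G x s"
      unfolding inner symb_def G_def by simp
    then have "exp (- 2 * H x s) * (\<integral>z. ?e z * symb z \<partial>lborel) = of_real H4.mass * G x s"
      by (simp add: exp_minus)
    moreover have "integrable lborel (\<lambda>z. \<integral>y. ?T y z \<partial>lborel)"
      by (rule lborel_pair.integrable_snd[OF i])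
    then have "integrable lborel (\<lambda>z. ?e z * symb z)" unfolding symb_def by simp
    ultimately show ?thesis by simp
  qed
  then show ?thesis using H4.mass_pos by blast
qed

text \<open>The test exponential peaks at \<open>(x + s) / 2\<close> with height
  \<open>exp (N (x + s))\<close>, and \<open>- 2 * Re (H x s) - N x - N s = - N (x + s)\<close>
  cancels this height exactly. The symbol occurs only under an integral, so an almost everywhere
  bound suffices.\<close>

lemma g_bounded:
  assumes B: "AE z in lborel. cmod (symb z) \<le> B"
  shows "\<exists>B'. \<forall>x s. g x s \<le> B'"
proof -
  obtain M where M: "M > 0" and int: "\<And>x s. integrable lborel (\<lambda>z. exp (4 * H x z + 4 * H z s - of_real (4 * N z)) * symb z)"
    and eq: "\<And>x s. of_real M * G x s = exp (- 2 * H x s) * (\<integral>z. exp (4 * H x z + 4 * H z s - of_real (4 * N z)) * symb z \<partial>lborel)"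
    using G_eq_symb by blast
  define J where "J = (\<integral>z. exp (- 4 * N z) \<partial>lborel)"
  have i4: "integrable lborel (\<lambda>z. exp (- 4 * N (z - b)))" for b
    using lborel_integrable_translate_iff[of "\<lambda>z. exp (- 4 * N z)" "-b"] integrable_exp_N[of 4] by simp
  have s4: "(\<integral>z. exp (- 4 * N (z - b)) \<partial>lborel) = J" for b
    unfolding J_def using lborel_integral_translate[of "\<lambda>z. exp (- 4 * N z)" "-b"] by simp
  have "g x s \<le> B * J / M" for x s
  proof -
    let ?b = "(1 / 2) *\<^sub>R (x + s)"
    let ?e = "\<lambda>z. exp (4 * H x z + 4 * H z s - of_real (4 * N z))"
    have h: "Re (H b a) = Re (H a b)" for a b using hermitian[of a b] by simp
    have n: "N (z - ?b) = N z + N (x + s) / 4 - Re (H z x) - Re (H z s)" for z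
      unfolding N_diff N_scaleR by (simp add: scaleR_right add_right power2_eq_square add_divide_distrib)
    have e: "cmod (?e z) = exp (N (x + s)) * exp (- 4 * N (z - ?b))" for z
      unfolding norm_exp_eq_Re exp_add[symmetric]
      by (rule arg_cong[where f = exp])
         (simp only: n, simp add: h[of x z])
    have "cmod (\<integral>z. ?e z * symb z \<partial>lborel) \<le> (\<integral>z. cmod (?e z * symb z) \<partial>lborel)"
      by (rule integral_norm_bound)
    also have "\<dots> \<le> (\<integral>z. (exp (N (x + s)) * B) * exp (- 4 * N (z - ?b)) \<partial>lborel)"
    proof (rule integral_mono_AE)
      show "integrable lborel (\<lambda>z. cmod (?e z * symb z))" by (intro integrable_norm int)
      show "integrable lborel (\<lambda>z. (exp (N (x + s)) * B) * exp (- 4 * N (z - ?b)))"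
        by (intro integrable_mult_right i4)
      show "AE z in lborel. cmod (?e z * symb z) \<le> (exp (N (x + s)) * B) * exp (- 4 * N (z - ?b))"
        using B
      proof eventually_elim
        case (elim z)
        then have "cmod (?e z) * cmod (symb z) \<le> cmod (?e z) * B" by (intro mult_left_mono) auto
        then show ?case unfolding norm_mult e by (simp add: mult_ac)
      qed
    qed
    also have "\<dots> = exp (N (x + s)) * B * J" by (simp only: integral_mult_right_zero s4)
    finally have I: "cmod (\<integral>z. ?e z * symb z \<partial>lborel) \<le> exp (N (x + s)) * B * J" .
    have "M * g x s = cmod (of_real M * G x s) * exp (- N x - N s)"
      using M by (simp add: g_def norm_mult)
    also have "\<dots> = exp (- 2 * Re (H x s) - N x - N s) * cmod (\<integral>z. ?e z * symb z \<partial>lborel)"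
      unfolding eq norm_mult norm_exp_eq_Re by (simp add: exp_diff exp_minus exp_add field_simps)
    also have "\<dots> \<le> exp (- 2 * Re (H x s) - N x - N s) * (exp (N (x + s)) * B * J)"
      by (rule mult_left_mono[OF I]) simp
    also have "\<dots> = B * J" by (simp add: N_add flip: exp_add mult.assoc)
    finally show ?thesis using M by (simp add: field_simps)
  qed
  then show ?thesis by blast
qed

text \<open>Expressing \<open>u\<close> through its reproducing formula before multiplying by
  \<open>exp (Q y)\<close> inserts a second Bergman kernel. Exchanging the integrals then leaves the
  \<open>y\<close> integral that defines \<open>G\<close>.\<close>

lemma red_toeplitz_le:
  assumes u: "u \<in> bargmann_space \<Phi>" and v: "(\<lambda>x. exp (Q x) * u x) \<in> wL2 \<Phi>"
  shows "ennreal (red (proj (\<lambda>x. exp (Q x) * u x)) x)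
    \<le> (\<integral>\<^sup>+s. ennreal (g x s / mass\<^sup>2) * ennreal (red u s) \<partial>lborel)"
proof -
  from u have u2: "u \<in> wL2 \<Phi>" by (simp add: bargmann_space_def)
  then have [measurable]: "u \<in> borel_measurable borel" by (auto simp: wL2_iff)
  let ?w = "\<lambda>y. complex_of_real (exp (- 2 * \<Phi> y))"
  let ?F = "\<lambda>y s. (kern x y * exp (Q y) * ?w y) * (kern y s * u s * ?w s)"
  let ?b = "\<lambda>y. exp (Re (Q y) - N (x - y))"
  \<comment> \<open>Attaching \<open>exp (Q y)\<close> to the outer kernel gives a square integrable
    factor, so the Fubini exchange rests on the size of \<open>u\<close> and not on that of
    \<open>exp (Q y) * u y\<close>.\<close>
  have b2: "integrable lborel (\<lambda>y. (?b y)\<^sup>2)"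
  proof -
    obtain K where "K > 0" and K: "\<And>x s y. exp (Re (Q y) - N (x - y) - N (y - s))
      \<le> exp (C0 + K * (norm x)\<^sup>2) * exp (- (\<epsilon> / 2) * (norm y)\<^sup>2 - m * (norm (y - s))\<^sup>2)"
      by (rule G_integrand_decay) blast
    show ?thesis
    proof (rule integrable_gauss_dominated[OF eps])
      fix y
      \<comment> \<open>Taking \<open>s = y\<close> in the decay bound removes the second Gaussian
        from both sides.\<close>
      have "?b y \<le> exp (C0 + K * (norm x)\<^sup>2) * exp (- (\<epsilon> / 2) * (norm y)\<^sup>2)"
        using K[of y x y] by (simp add: N_def linear_0[OF linear_left])
      then have "(?b y)\<^sup>2 \<le> (exp (C0 + K * (norm x)\<^sup>2) * exp (- (\<epsilon> / 2) * (norm y)\<^sup>2))\<^sup>2"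
        by (intro power_mono) auto
      then show "norm ((?b y)\<^sup>2) \<le> (exp (C0 + K * (norm x)\<^sup>2))\<^sup>2 * exp (- \<epsilon> * (norm y)\<^sup>2)"
        by (simp add: power_mult_distrib exp_double[symmetric])
    qed simp
  qed
  have Fnorm: "cmod (?F y s) = exp (\<Phi> x) * (exp (- N (y - s)) * (?b y * red u s))" for y s
  proof -
    have "cmod (kern x y * exp (Q y) * ?w y) = exp (\<Phi> x) * ?b y * exp (- \<Phi> y)"
      by (simp add: norm_mult cmod_kern flip: exp_add)
    then show ?thesis
      unfolding norm_mult[of "kern x y * exp (Q y) * ?w y"] cmod_kern_integrand
      by (simp add: exp_minus)
  qed
  have Fm: "(\<lambda>(y, s). ?F y s) \<in> borel_measurable (lborel \<Otimes>\<^sub>M lborel)" by measurable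
  have i: "integrable (lborel \<Otimes>\<^sub>M lborel) (\<lambda>(y, s). ?F y s)"
  proof (rule Bochner_Integration.integrable_bound[OF _ Fm])
    have "integrable (lborel \<Otimes>\<^sub>M lborel) (\<lambda>(y, s). exp (- N (y - s)) * (?b y * red u s))"
      by (rule integrable_kernel_L2[OF sigma_finite_lborel sigma_finite_lborel _ _ _ _
            eq_refl[OF nn_integral_exp_N_shift(1)] eq_refl[OF nn_integral_exp_N_shift(2)]])
         (use u2 b2 in \<open>auto simp: wL2_iff\<close>)
    from integrable_mult_right[OF this, of "exp (\<Phi> x)"]
    show "integrable (lborel \<Otimes>\<^sub>M lborel) (\<lambda>(y, s). exp (\<Phi> x) * (exp (- N (y - s)) * (?b y * red u s)))"
      by (simp add: case_prod_unfold)
    show "AE z in lborel \<Otimes>\<^sub>M lborel. norm (case z of (y, s) \<Rightarrow> ?F y s)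
        \<le> norm (case z of (y, s) \<Rightarrow> exp (\<Phi> x) * (exp (- N (y - s)) * (?b y * red u s)))"
      unfolding split_beta Fnorm by simp
  qed
  have inner: "(\<integral>y. ?F y s \<partial>lborel) = exp (f x + cnj (f s)) * G x s * (u s * ?w s)" for s
  proof -
    have F: "?F y s = (exp (f x + cnj (f s)) * (u s * ?w s)) * G_integrand x s y" for y
    proof -
      have e: "(f x + cnj (f y) + 2 * H x y) + Q y + of_real (- 2 * \<Phi> y) + (f y + cnj (f s) + 2 * H y s)
        = (f x + cnj (f s)) + (2 * H x y + 2 * H y s - of_real (2 * N y) + Q y)"
        by (simp add: \<Phi>_eq complex_eq_iff)
      have "kern x y * exp (Q y) * ?w y * kern y s = exp (f x + cnj (f s)) * G_integrand x s y"
        unfolding kern_def G_integrand_def exp_of_real[symmetric] exp_add[symmetric] e ..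
      then show ?thesis by (simp add: mult_ac)
    qed
    show ?thesis unfolding G_def F integral_mult_right_zero by (simp only: mult_ac)
  qed
  \<comment> \<open>Two factors \<open>mass\<close> clear two normalisations: that of the projection
    and that of the reproducing formula for \<open>u\<close>.\<close>
  have "proj (\<lambda>x. exp (Q x) * u x) x * of_real (mass\<^sup>2)
      = of_real mass * (\<integral>y. kern x y * (exp (Q y) * u y) * ?w y \<partial>lborel)"
    using mass_pos by (simp add: proj_def power2_eq_square)
  also have "\<dots> = (\<integral>y. (kern x y * exp (Q y) * ?w y) * (of_real mass * u y) \<partial>lborel)"
    unfolding integral_mult_right_zero[symmetric] by (simp only: mult_ac)
  also have "\<dots> = (\<integral>y. (\<integral>s. ?F y s \<partial>lborel) \<partial>lborel)"
    unfolding reproducing_kern[OF u, symmetric] integral_mult_right_zero ..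
  also have "\<dots> = (\<integral>s. (\<integral>y. ?F y s \<partial>lborel) \<partial>lborel)"
    by (rule lborel_pair.Fubini_integral[OF i, symmetric])
  finally have P: "proj (\<lambda>x. exp (Q x) * u x) x * of_real (mass\<^sup>2) = (\<integral>s. (\<integral>y. ?F y s \<partial>lborel) \<partial>lborel)" .
  have Gm: "(\<lambda>s. g x s) \<in> borel_measurable lborel"
    using measurable_Pair2[OF measurable_g, of x] by simp
  have "ennreal (red (proj (\<lambda>x. exp (Q x) * u x)) x)
      = ennreal (exp (- \<Phi> x) / mass\<^sup>2) * ennreal (cmod (proj (\<lambda>x. exp (Q x) * u x) x * of_real (mass\<^sup>2)))"
    using mass_pos by (simp add: red_def norm_mult norm_power ennreal_mult[symmetric])
  also have "\<dots> \<le> ennreal (exp (- \<Phi> x) / mass\<^sup>2) * (\<integral>\<^sup>+s. ennreal (cmod (\<integral>y. ?F y s \<partial>lborel)) \<partial>lborel)"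
    unfolding P by (intro mult_left_mono integral_norm_bound_ennreal lborel_pair.integrable_snd[OF i]) simp
  also have "\<dots> = (\<integral>\<^sup>+s. ennreal (exp (- \<Phi> x) / mass\<^sup>2) * ennreal (cmod (\<integral>y. ?F y s \<partial>lborel)) \<partial>lborel)"
    by (rule nn_integral_cmult[symmetric])
       (use borel_measurable_integrable[OF lborel_pair.integrable_snd[OF i]] in measurable)
  also have "\<dots> = (\<integral>\<^sup>+s. ennreal (g x s / mass\<^sup>2) * ennreal (red u s) \<partial>lborel)"
  proof (rule nn_integral_cong)
    fix s
    have "exp (- \<Phi> x) * cmod (\<integral>y. ?F y s \<partial>lborel) = g x s * red u s"
    proof -
      have "exp (- \<Phi> x) * cmod (\<integral>y. ?F y s \<partial>lborel)
        = (exp (- \<Phi> x) * exp (Re (f x) + Re (f s)) * exp (- 2 * \<Phi> s)) * cmod (G x s) * cmod (u s)"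
        unfolding inner by (simp add: norm_mult)
      also have "exp (- \<Phi> x) * exp (Re (f x) + Re (f s)) * exp (- 2 * \<Phi> s) = exp (- N x - N s) * exp (- \<Phi> s)"
        unfolding exp_add[symmetric] by (simp add: \<Phi>_eq)
      finally show ?thesis by (simp add: g_def red_def)
    qed
    then have "exp (- \<Phi> x) / mass\<^sup>2 * cmod (\<integral>y. ?F y s \<partial>lborel) = g x s / mass\<^sup>2 * red u s"
      by (simp add: field_simps)
    then show "ennreal (exp (- \<Phi> x) / mass\<^sup>2) * ennreal (cmod (\<integral>y. ?F y s \<partial>lborel))
        = ennreal (g x s / mass\<^sup>2) * ennreal (red u s)"
      by (simp add: ennreal_mult[symmetric] g_nonneg del: times_divide_eq_left times_divide_eq_right)
  qed
  finally show ?thesis .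
qed

lemma toeplitz_bounded:
  assumes B: "AE z in lborel. cmod (symb z) \<le> B"
  shows "toeplitz_exp_bounded \<Phi> Q"
proof -
  obtain B' where B': "\<And>x s. g x s \<le> B'" using g_bounded[OF B] by blast
  obtain E E' where split: "\<And>x1 s1 x2 s2. g x1 s1 * g x2 s2 = E (x1 + x2) (s1 + s2) * E' (x1 - x2) (s1 - s2)"
    by (rule g_split) blast
  have d: "min (\<epsilon> / 4) m / 2 > 0" using eps m_pos by simp
  obtain A1 where A1: "A1 \<ge> 0" "\<And>x. (\<integral>\<^sup>+s. ennreal (g x s) \<partial>lborel) \<le> ennreal A1"
    using quasi_gaussian_uniform_integral[of g, OF g_nonneg B' split d g_decay(1)] by blast
  obtain A2 where A2: "A2 \<ge> 0" "\<And>s. (\<integral>\<^sup>+x. ennreal (g x s) \<partial>lborel) \<le> ennreal A2"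
    using quasi_gaussian_uniform_integral[of "\<lambda>s x. g x s" B' "\<lambda>s x. E x s" "\<lambda>s x. E' x s", OF g_nonneg B' split d g_decay(2)] by blast
  note [measurable] = measurable_g
  have gm: "(\<lambda>s. g x s) \<in> borel_measurable lborel" "(\<lambda>x. g x s) \<in> borel_measurable lborel" for x s
    by measurable
  have m2: "mass\<^sup>2 > 0" using mass_pos by simp
  have s: "(\<integral>\<^sup>+s. ennreal (g x s / mass\<^sup>2) \<partial>lborel) \<le> ennreal (A1 / mass\<^sup>2)"
    "(\<integral>\<^sup>+x. ennreal (g x s / mass\<^sup>2) \<partial>lborel) \<le> ennreal (A2 / mass\<^sup>2)" for x s
    using A1 A2 gm m2 g_nonneg
    by (simp_all add: divide_ennreal[symmetric] nn_integral_divide divide_right_mono_ennreal)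
  show ?thesis
    unfolding toeplitz_exp_bounded_def
  proof (intro exI ballI impI)
    fix u assume u: "u \<in> bargmann_space \<Phi>" and v: "(\<lambda>x. exp (Q x) * u x) \<in> wL2 \<Phi>"
    have u2: "u \<in> wL2 \<Phi>" using u by (simp add: bargmann_space_def)
    have w: "proj (\<lambda>x. exp (Q x) * u x) \<in> borel_measurable borel"
      by (rule cn_holomorphic_measurable[OF cn_holomorphic_proj[OF v]])
    show "wnorm \<Phi> (bargmann_proj \<Phi> (\<lambda>x. exp (Q x) * u x))
        \<le> sqrt (A1 / mass\<^sup>2 * (A2 / mass\<^sup>2)) * wnorm \<Phi> u"
      unfolding bargmann_proj_eq[OF v]
      by (rule wL2_integral_operator(2)[OF u2 w _ _ s _ _ red_toeplitz_le[OF u v]])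
         (use A1 A2 m2 g_nonneg in auto)
  qed
qed

end

section \<open>Quadratic forms\<close>

text \<open>\<open>M\<close> need not be self-adjoint, so the bilinear form is symmetrised.\<close>

lemma real_qformE:
  assumes "real_qform \<Phi>"
  obtains B where "bilinear B" "\<And>x y. B x y = B y x" "\<And>x. \<Phi> x = B x x"
proof -
  obtain M where M: "linear M" "\<And>x. \<Phi> x = x \<bullet> M x" using assms by (auto simp: real_qform_def)
  show ?thesis
  proof (rule that[of "\<lambda>x y. (x \<bullet> M y + y \<bullet> M x) / 2"])
    show "bilinear (\<lambda>x y. (x \<bullet> M y + y \<bullet> M x) / 2)"
      unfolding bilinear_def
      by (intro conjI allI linearI)
         (simp_all add: linear_add[OF M(1)] linear_scale[OF M(1)] inner_add add_divide_distrib distrib_left)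
  qed (simp_all add: M add.commute)
qed

lemma real_qform_parallelogram:
  assumes "real_qform \<Phi>"
  shows "\<Phi> (x + y) + \<Phi> (x - y) = 2 * \<Phi> x + 2 * \<Phi> y"
proof -
  obtain B where B: "bilinear B" "\<And>x y. B x y = B y x" "\<And>x. \<Phi> x = B x x"
    using assms by (rule real_qformE) blast
  then show ?thesis
    by (simp add: bilinear_ladd bilinear_radd bilinear_lsub bilinear_rsub)
qed

lemma real_qform_scaleR: "real_qform \<Phi> \<Longrightarrow> \<Phi> (r *\<^sub>R x) = r\<^sup>2 * \<Phi> x"
  by (auto simp: real_qform_def linear_scale power2_eq_square)

lemma real_qform_continuous:
  fixes \<Phi> :: "'a::euclidean_space \<Rightarrow> real"
  assumes "real_qform \<Phi>"
  shows "continuous_on UNIV \<Phi>"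
proof -
  obtain M where M: "linear M" "\<And>x. \<Phi> x = x \<bullet> M x" using assms by (auto simp: real_qform_def)
  have "continuous_on UNIV M" using M(1) by (simp add: linear_continuous_on linear_linear)
  then show ?thesis unfolding M(2) by (intro continuous_intros)
qed

lemma complex_qform_parallelogram:
  assumes "complex_qform q"
  shows "q (x + y) + q (x - y) = 2 * q x + 2 * q y"
  using real_qform_parallelogram[of "\<lambda>x. Re (q x)"] real_qform_parallelogram[of "\<lambda>x. Im (q x)"] assms
  by (simp add: complex_qform_def complex_eq_iff)

text \<open>Compactness of the unit sphere turns strict positivity into a quantitative constant,
  both for the Hermitian form and for the gap between \<open>N\<close> and
  \<open>Re q\<close>.\<close>

lemma coercive_of_positive:
  fixes P :: "'a::euclidean_space \<Rightarrow> real"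
  assumes cont: "continuous_on UNIV P" and hom: "\<And>r x. P (r *\<^sub>R x) = r\<^sup>2 * P x"
    and pos: "\<And>x. x \<noteq> 0 \<Longrightarrow> P x > 0"
  obtains m where "m > 0" "\<And>x. m * (norm x)\<^sup>2 \<le> P x"
proof -
  obtain b :: 'a where "norm b = 1" using vector_choose_size[of 1] by auto
  then have "sphere 0 1 \<noteq> ({} :: 'a set)" by auto
  with continuous_attains_inf[OF compact_sphere this continuous_on_subset[OF cont]]
  obtain x0 where x0: "norm x0 = 1" "\<And>y. norm y = 1 \<Longrightarrow> P x0 \<le> P y" by auto
  show ?thesis
  proof (rule that[of "P x0"])
    show "P x0 > 0" using x0(1) by (intro pos) auto
    fix x
    show "P x0 * (norm x)\<^sup>2 \<le> P x"
    proof (cases "x = 0")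
      case True
      then show ?thesis using hom[of 0 x] by simp
    next
      case False
      then have "P x0 * (norm x)\<^sup>2 \<le> P ((1 / norm x) *\<^sub>R x) * (norm x)\<^sup>2"
        by (intro mult_right_mono x0(2)) auto
      also have "\<dots> = P x" using False by (simp add: hom power_divide)
      finally show ?thesis .
    qed
  qed
qed

section \<open>Pluriharmonic and Hermitian parts of a real quadratic form\<close>

lemma cscale_homogeneous:
  assumes "linear l" "\<And>v. l (cscale \<i> v) = \<i> * l v"
  shows "l (cscale c v) = c * l v"
proof -
  have "cscale c v = Re c *\<^sub>R v + Im c *\<^sub>R cscale \<i> v"
    by (simp only: cscale_of_real[symmetric] cscale_simps cscale_add_left[symmetric] complex_eq[symmetric] mult.commute)
  then have "l (cscale c v) = (of_real (Re c) + of_real (Im c) * \<i>) * l v"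
    using assms by (simp add: linear_add linear_scale scaleR_conv_of_real[where 'a = complex] distrib_right mult.assoc)
  then show ?thesis by (simp add: complex_eq[of c, symmetric] mult.commute)
qed

text \<open>\<open>Re (P x y)\<close> is the part of \<open>B\<close> that changes sign under
  multiplication of both arguments by \<open>\<i>\<close>. The imaginary part is the one that makes
  \<open>P\<close> complex bilinear, so its diagonal is holomorphic.\<close>

lemma pluriharmonic_part:
  fixes \<Phi> :: "complex ^ 'n \<Rightarrow> real"
  assumes "real_qform \<Phi>"
  obtains f where "cn_holomorphic f" "\<And>x. \<Phi> x = phi_herm \<Phi> x + Re (f x)"
proof -
  obtain B where B: "bilinear B" "\<And>x y. B x y = B y x" "\<And>x. \<Phi> x = B x x"
    using assms by (rule real_qformE) blast
  note B_simps = bilinear_ladd[OF B(1)] bilinear_radd[OF B(1)] bilinear_lmul[OF B(1)] bilinear_rmul[OF B(1)]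
    bilinear_lneg[OF B(1)] bilinear_rneg[OF B(1)]
  let ?J = "cscale \<i>"
  define P where "P x y = Complex ((B x y - B (?J x) (?J y)) / 2) (- (B x (?J y) + B (?J x) y) / 2)" for x y
  have lin: "linear (P x)" "linear (\<lambda>x. P x y)" for x y
    by (rule linearI; simp add: P_def complex_eq_iff cscale_add cscale_scaleR B_simps field_simps)+
  have J: "P x (?J y) = \<i> * P x y" "P (?J x) y = \<i> * P x y" for x y
    by (simp_all add: P_def complex_eq_iff B_simps field_simps)
  have bb: "bounded_bilinear P"
    using lin by (simp add: bilinear_conv_bounded_bilinear[symmetric] bilinear_def)
  define f where "f x = P x x" for x
  have "cn_holomorphic f"
  proof (rule cn_holomorphicI)
    fix x
    show "(f has_derivative (\<lambda>h. P x h + P h x)) (at x)"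
      unfolding f_def by (rule bounded_bilinear.FDERIV[OF bb has_derivative_ident has_derivative_ident])
    show "P x (cscale c v) + P (cscale c v) x = c * (P x v + P v x)" for c v
      by (simp add: cscale_homogeneous[OF lin(1) J(1)] cscale_homogeneous[OF lin(2) J(2)] distrib_left)
  qed
  moreover have "\<Phi> x = phi_herm \<Phi> x + Re (f x)" for x
    by (simp add: f_def P_def phi_herm_def B(3) field_simps)
  ultimately show ?thesis using that by blast
qed

lemma dirder_real_qform:
  fixes B :: "complex ^ 'n \<Rightarrow> complex ^ 'n \<Rightarrow> real"
  assumes B: "bilinear B" "\<And>x y. B x y = B y x"
  shows "dirder (dirder (\<lambda>y. complex_of_real (B y y)) w) v x = complex_of_real (2 * B v w)"
proof -
  note B_simps = bilinear_ladd[OF B(1)] bilinear_radd[OF B(1)] bilinear_lmul[OF B(1)] bilinear_rmul[OF B(1)]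
  have "((\<lambda>s. complex_of_real (B (x + s *\<^sub>R w) (x + s *\<^sub>R w))) has_vector_derivative of_real (2 * B x w)) (at 0)" for x
  proof -
    have "(\<lambda>s. complex_of_real (B (x + s *\<^sub>R w) (x + s *\<^sub>R w)))
        = (\<lambda>s. complex_of_real (B x x + 2 * s * B x w + s\<^sup>2 * B w w))"
      by (simp add: B_simps B(2)[of w x] power2_eq_square algebra_simps)
    moreover have "((\<lambda>s. B x x + 2 * s * B x w + s\<^sup>2 * B w w) has_real_derivative 2 * B x w) (at 0)"
      by (auto intro!: derivative_eq_intros)
    ultimately show ?thesis
      by (simp only: has_vector_derivative_of_real has_real_derivative_iff_has_vector_derivative)
  qed
  then have 1: "dirder (\<lambda>y. complex_of_real (B y y)) w = (\<lambda>x. of_real (2 * B x w))"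
    unfolding dirder_def by (intro ext vector_derivative_at)
  have "((\<lambda>s. complex_of_real (2 * B (x + s *\<^sub>R v) w)) has_vector_derivative of_real (2 * B v w)) (at 0)"
  proof -
    have "((\<lambda>s. 2 * B (x + s *\<^sub>R v) w) has_real_derivative 2 * B v w) (at 0)"
      by (auto simp: B_simps intro!: derivative_eq_intros)
    then show ?thesis
      by (simp only: has_vector_derivative_of_real has_real_derivative_iff_has_vector_derivative)
  qed
  then show ?thesis unfolding 1 dirder_def by (rule vector_derivative_at)
qed

text \<open>\<open>Re (H x y)\<close> is the part of \<open>B\<close> invariant under multiplication
  of both arguments by \<open>\<i>\<close>, and the imaginary part makes \<open>H\<close>
  sesquilinear. Its matrix in the standard basis is the complex Hessian of \<open>\<Phi>\<close>, so
  strict plurisubharmonicity is positive definiteness of \<open>H\<close>.\<close>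

lemma hermitian_part:
  fixes \<Phi> :: "complex ^ 'n \<Rightarrow> real"
  assumes "real_qform \<Phi>" and psh: "strictly_psh \<Phi>"
  obtains H m where "hermitian_form H m" "\<And>x. Re (H x x) = phi_herm \<Phi> x"
proof -
  obtain B where B: "bilinear B" "\<And>x y. B x y = B y x" "\<And>x. \<Phi> x = B x x"
    using assms(1) by (rule real_qformE) blast
  note B_simps = bilinear_ladd[OF B(1)] bilinear_radd[OF B(1)] bilinear_lmul[OF B(1)] bilinear_rmul[OF B(1)]
    bilinear_lneg[OF B(1)] bilinear_rneg[OF B(1)]
  let ?J = "cscale \<i>"
  define H where "H x y = Complex ((B x y + B (?J x) (?J y)) / 2) ((B x (?J y) - B (?J x) y) / 2)" for x y
  have add: "H (x + y) z = H x z + H y z" for x y z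
    by (simp add: H_def complex_eq_iff cscale_add B_simps field_simps)
  have lin: "linear (\<lambda>x. H x y)" for y
    by (rule linearI; simp add: H_def complex_eq_iff cscale_add cscale_scaleR B_simps field_simps)
  have J: "H (?J x) y = \<i> * H x y" for x y
    by (simp add: H_def complex_eq_iff B_simps field_simps)
  have scale: "H (cscale c x) y = c * H x y" for c x y by (rule cscale_homogeneous[OF lin J])
  have herm: "H y x = cnj (H x y)" for x y
    by (simp add: H_def complex_eq_iff B(2)[of y x] B(2)[of "?J y"] B(2)[of y "?J x"] field_simps)
  have scale_right: "H x (cscale c y) = cnj c * H x y" for x c y
    by (metis scale herm complex_cnj_mult)
  have hess: "complex_hessian (\<lambda>y. complex_of_real (\<Phi> y)) x $ j $ k = H (axis j 1) (axis k 1)" for x j k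
  proof -
    have ax: "axis j \<i> = ?J (axis j 1)" for j :: 'n by (simp add: cscale_def axis_def vec_eq_iff)
    show ?thesis
      unfolding complex_hessian_def wirt_mixed_def Let_def B(3) dirder_real_qform[OF B(1,2)] ax
      by (simp add: H_def complex_eq_iff)
  qed
  have expand: "H t t = (\<Sum>j\<in>UNIV. \<Sum>k\<in>UNIV. H (axis j 1) (axis k 1) * t $ j * cnj (t $ k))" for t
  proof -
    have t: "t = (\<Sum>j\<in>UNIV. cscale (t $ j) (axis j 1))"
      by (simp add: vec_eq_iff cscale_def axis_def if_distrib sum.delta cong: if_cong)
    have lin': "linear (H x)" for x
      by (rule linearI; simp add: H_def complex_eq_iff cscale_add cscale_scaleR B_simps field_simps)
    have "H t t = (\<Sum>j\<in>UNIV. H (cscale (t $ j) (axis j 1)) t)"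
      by (subst (1) t) (simp only: linear_sum[OF lin])
    also have "\<dots> = (\<Sum>j\<in>UNIV. \<Sum>k\<in>UNIV. H (cscale (t $ j) (axis j 1)) (cscale (t $ k) (axis k 1)))"
      by (rule sum.cong[OF refl], subst (2) t) (simp only: linear_sum[OF lin'])
    finally show ?thesis by (simp add: scale scale_right mult_ac)
  qed
  have diag: "Re (H x x) = phi_herm \<Phi> x" for x
    by (simp add: H_def phi_herm_def B(3))
  have pos: "Re (H t t) > 0" if "t \<noteq> 0" for t
    using psh that unfolding strictly_psh_def expand hess by blast
  have cont: "continuous_on UNIV (\<lambda>x. Re (H x x))"
    unfolding diag phi_herm_def
    by (intro continuous_intros real_qform_continuous[OF assms(1)]
        continuous_on_compose2[OF real_qform_continuous[OF assms(1)]]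
        linear_continuous_on[OF bounded_linear_cscale]) auto
  have hom: "Re (H (r *\<^sub>R x) (r *\<^sub>R x)) = r\<^sup>2 * Re (H x x)" for r x
    unfolding cscale_of_real[symmetric] scale scale_right by (simp add: power2_eq_square)
  obtain m where m: "m > 0" "\<And>x. m * (norm x)\<^sup>2 \<le> Re (H x x)"
    using coercive_of_positive[OF cont hom pos] by blast
  have "hermitian_form H m"
    by (rule hermitian_form.intro[OF add scale herm m])
  then show ?thesis using diag by (rule that)
qed

lemma quad_poly_upper_bound:
  fixes L :: "'a::euclidean_space \<Rightarrow> complex"
  assumes "linear L" "\<epsilon> > 0"
  obtains C where "\<And>y. Re (L y + c) \<le> \<epsilon> * (norm y)\<^sup>2 + C"
proof -
  obtain K where K: "\<And>y. cmod (L y) \<le> K * norm y"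
    using linear_bounded[OF assms(1)] by blast
  have "Re (L y + c) \<le> \<epsilon> * (norm y)\<^sup>2 + (K\<^sup>2 / (4 * \<epsilon>) + Re c)" for y
  proof -
    have "0 \<le> (2 * \<epsilon> * norm y - K)\<^sup>2 / (4 * \<epsilon>)" using assms(2) by simp
    also have "\<dots> = \<epsilon> * (norm y)\<^sup>2 - K * norm y + K\<^sup>2 / (4 * \<epsilon>)"
      using assms(2) by (simp add: power2_eq_square field_simps)
    finally show ?thesis using K[of y] complex_Re_le_cmod[of "L y"] by simp
  qed
  then show ?thesis by (rule that)
qed

theorem theorem1p1:
  fixes \<Phi>0 :: "complex ^ 'n \<Rightarrow> real"
    and Q q :: "complex ^ 'n \<Rightarrow> complex"
    and a :: "complex ^ 'n \<Rightarrow> complex"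
  assumes "real_qform \<Phi>0"
    and "strictly_psh \<Phi>0"
    and "quad_poly_with_principal_part Q q"
    and "\<forall>x. x \<noteq> 0 \<longrightarrow> Re (q x) < phi_herm \<Phi>0 x"
    and "\<forall>x. det (complex_hessian (\<lambda>y. 2 * complex_of_real (\<Phi>0 y) - q y) x) \<noteq> 0"
    and "\<exists>C. C \<noteq> 0 \<and> (\<forall>x. a x = C * toeplitz_weyl_integral \<Phi>0 Q x)"
    and "\<exists>B. AE x in lborel. cmod (a x) \<le> B"
  shows "toeplitz_exp_bounded \<Phi>0 Q"
proof -
  obtain H m where "hermitian_form H m" and H: "\<And>x. Re (H x x) = phi_herm \<Phi>0 x"
    using hermitian_part[OF assms(1,2)] by blast
  interpret hermitian_form H m by fact
  have N: "N x = phi_herm \<Phi>0 x" for x by (simp add: N_def H)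
  obtain f where f: "cn_holomorphic f" "\<And>x. \<Phi>0 x = phi_herm \<Phi>0 x + Re (f x)"
    using pluriharmonic_part[OF assms(1)] by blast
  obtain L c where q: "complex_qform q" and L: "linear L" and Q: "\<And>x. Q x = q x + L x + c"
    using assms(3) by (auto simp: quad_poly_with_principal_part_def)
  have q_re: "real_qform (\<lambda>x. Re (q x))" and q_im: "real_qform (\<lambda>x. Im (q x))"
    using q by (simp_all add: complex_qform_def)
  have cont_N: "continuous_on UNIV N" unfolding N_def by (intro continuous_intros)
  obtain \<delta> where \<delta>: "\<delta> > 0" "\<And>x. \<delta> * (norm x)\<^sup>2 \<le> N x - Re (q x)"
  proof (rule coercive_of_positive[of "\<lambda>x. N x - Re (q x)"])
    show "continuous_on UNIV (\<lambda>x. N x - Re (q x))"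
      by (intro continuous_intros cont_N real_qform_continuous[OF q_re])
    show "N (r *\<^sub>R x) - Re (q (r *\<^sub>R x)) = r\<^sup>2 * (N x - Re (q x))" for r x
      by (simp add: N_scaleR real_qform_scaleR[OF q_re] right_diff_distrib)
    show "x \<noteq> 0 \<Longrightarrow> 0 < N x - Re (q x)" for x using assms(4) by (simp add: N)
  qed blast
  \<comment> \<open>Half of the gap \<open>\<delta>\<close> absorbs the affine part of
    \<open>Q\<close>; the other half becomes the margin \<open>\<epsilon>\<close> of the Gaussian
    estimates.\<close>
  obtain C0 where C0: "\<And>y. Re (L y + c) \<le> (\<delta> / 2) * (norm y)\<^sup>2 + C0"
    using quad_poly_upper_bound[OF L, of "\<delta> / 2" c] \<delta>(1) by auto
  have cont_q: "continuous_on UNIV (\<lambda>x. of_real (Re (q x)) + \<i> * of_real (Im (q x)))"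
    by (intro continuous_intros real_qform_continuous q_re q_im)
  have "continuous_on UNIV Q"
    using cont_q L unfolding complex_eq[symmetric] Q
    by (intro continuous_intros) (auto simp: linear_continuous_on linear_linear)
  then have Qm: "Q \<in> borel_measurable borel" by (rule borel_measurable_continuous_onI)
  interpret toeplitz_gaussian H m f \<Phi>0 Q q L c "\<delta> / 2" C0
  proof unfold_locales
    fix y show "Re (Q y) \<le> N y - \<delta> / 2 * (norm y)\<^sup>2 + C0"
      using C0[of y] \<delta>(2)[of y] by (simp add: Q)
  qed (use f Q Qm \<delta>(1) complex_qform_parallelogram[OF q] linear_add[OF L] linear_scale[OF L] in \<open>auto simp: N\<close>)
  have symb: "symb = toeplitz_weyl_integral \<Phi>0 Q"
    by (simp add: fun_eq_iff symb_def toeplitz_weyl_integral_def N)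
  obtain C B where C: "C \<noteq> 0" "\<And>x. a x = C * symb x" and B: "AE x in lborel. cmod (a x) \<le> B"
    using assms(6,7) unfolding symb by blast
  have "AE x in lborel. cmod (symb x) \<le> B / cmod C"
    using B C(1) unfolding C(2) by (simp add: norm_mult field_simps)
  then show ?thesis by (rule toeplitz_bounded)
qed

end
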